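(* Let $Q\in\mathbb{R}^{n\times n}$ be symmetric (not necessarily positive semidefinite), $q\in\mathbb{R}^n$, $A\in\mathbb{R}^{m\times n}$, $\ell,u\in\mathbb{R}^m$, and $C=\{z\in\mathbb{R}^m : \ell\le z\le u\}$. Consider the quadratic program $$\text{(QP)}\qquad \operatorname*{minimize}_{x\in\mathbb{R}^n}\ \tfrac12 x^\top Qx+q^\top x\quad\text{subject to}\quad Ax\in C,$$ and suppose that it is lower bounded, i.e. that the feasible set $\{x : Ax\in C\}$ is nonempty and the objective is bounded below on it. Let $f(x)=\tfrac12x^\top Qx+q^\top x$ and $g(z)=\delta_C(z)$ (the indicator function of $C$), and consider any iterates $(x^{k+1},z^{k+1},y^{k+1},\hat x^{k+1})_{k\in\mathbb{N}}$ generated by the proximal augmented Lagrangian method (P-ALM) described in the context. Then the following hold. (i) For every $k\in\mathbb{N}$, the triplet $(x^{k+1},y^{k+1},z^{k+1})$ satisfies $$\|\nabla f(x^{k+1})+A^\top y^{k+1}\|\le\delta_k+\|\Sigma_{\mathsf x}^{-1}(x^{k+1}-\hat x^k)\|\qquad\text{and}\qquad y^{k+1}\in\partial g(z^{k+1}).$$ (ii) The test $\|Ax^{k+1}-z^{k+1}\|_{\Sigma_{\mathsf y,k}}\le\varepsilon_k$ in step 3 of P-ALM is satisfied for infinitely many $k$, and $\|\hat x^{k+1}-\hat x^k\|\to0$ as $k\to\infty$. In particular, for all tolerances $\epsilon_{\rm p},\epsilon_{\rm d}>0$, the termination criteria $$\|\nabla f(x^{k+1})+A^\top y^{k+1}\|\le\epsilon_{\rm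 d},\qquad y^{k+1}\in\partial g(z^{k+1}),\qquad \|Ax^{k+1}-z^{k+1}\|\le\epsilon_{\rm p}$$ are satisfied in a finite number of iterations. (iii) The sequence $(\hat x^k)_{k\in\mathbb{N}}$ converges to a stationary point of (QP). In fact, letting $k_0<k_1<\dots$ be the (infinitely many) indices $k$ at which the test in step 3 is satisfied, the sequence $(x^{k_i+1})_{i\in\mathbb{N}}$ converges at $R$-linear rate.
   Context: Notation. $\|\cdot\|$ is the Euclidean norm; for a symmetric positive definite matrix $\Sigma$, $\|x\|_\Sigma=\sqrt{\langle x,\Sigma x\rangle}$. For symmetric matrices, $M\succeq N$ (resp. $M\succ N$) means $M-N$ is positive semidefinite (resp. positive definite). $\Pi_C$ is the Euclidean projection onto $C$. The indicator function is $\delta_C(z)=0$ if $z\in C$ and $+\infty$ otherwise, and $\partial\delta_C(z)$ is the normal cone $\{v : \langle v,z'-z\rangle\le0\ \forall z'\in C\}$ if $z\in C$ and $\emptyset$ otherwise. (The scalars $\delta_k$ below are tolerances, unrelated to the indicator function $\delta_C$.) A point $x$ is stationary for (QP) if it is stationary for $\varphi(x)=\tfrac12x^\top Qx+q^\top x+\delta_C(Ax)$, i.e. $\varphi(x)<\infty$ and $\liminf_{x'\to x,\,x'\ne x}\frac{\varphi(x')-\varphi(x)}{\|x'-x\|}\ge0$ (that is, $0$ belongs to the regular subdifferential of $\varphi$ at $x$). A sequence $(w^i)$ converges at $R$-linear rate if it converges to some $w^\star$ and there exist $c>0$, $r\in(0,1)$ with $\|w^i-w^\star\|\le c\,r^i$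 for all $i$. Algorithm (P-ALM). Inputs: $(\hat x^0,y^0)\in\mathbb{R}^n\times\mathbb{R}^m$; $\delta_0,\varepsilon_0>0$; $\rho\in(0,1)$; a symmetric positive definite $\Sigma_{\mathsf y,\min}\in\mathbb{R}^{m\times m}$ and $\Sigma_{\mathsf y,0}\succeq\Sigma_{\mathsf y,\min}$; a symmetric positive definite $\Sigma_{\mathsf x}\in\mathbb{R}^{n\times n}$ such that $Q+\Sigma_{\mathsf x}^{-1}\succ0$. All matrices $\Sigma_{\mathsf y,k}$ are diagonal, and all tolerances $\delta_k,\varepsilon_k$ are positive. For $k=0,1,2,\dots$: 1. Let $x^{k+1}\in\mathbb{R}^n$ be any point such that $$\bigl\|Qx^{k+1}+q+A^\top\bigl(y^k+\Sigma_{\mathsf y,k}(Ax^{k+1}-z^{k+1})\bigr)+\Sigma_{\mathsf x}^{-1}(x^{k+1}-\hat x^k)\bigr\|\le\delta_k,\quad\text{where } z^{k+1}=\Pi_C\bigl(Ax^{k+1}+\Sigma_{\mathsf y,k}^{-1}y^k\bigr).$$ 2. Set $y^{k+1}=y^k+\Sigma_{\mathsf y,k}(Ax^{k+1}-z^{k+1})$. 3. If $\|Ax^{k+1}-z^{k+1}\|_{\Sigma_{\mathsf y,k}}\le\varepsilon_k$, then set $\hat x^{k+1}=x^{k+1}$ and choose any $\Sigma_{\mathsf y,k+1}\succeq\Sigma_{\mathsf y,\min}$ and $\varepsilon_{k+1}\le\rho\,\varepsilon_k$. Otherwise set $\hat x^{k+1}=\hat x^k$, $\varepsilon_{k+1}=\varepsilon_k$,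 and choose any $\Sigma_{\mathsf y,k+1}\succeq\Sigma_{\mathsf y,k}$. 4. Choose $\delta_{k+1}\le\rho\,\delta_k$. *)

theory Defs
  imports "HOL-Analysis.Analysis"
begin

text \<open>Definiteness is only used for symmetric matrices, so symmetry is part of the definitions.\<close>

definition pos_semidef :: "real^'n^'n \<Rightarrow> bool" where
  "pos_semidef M \<longleftrightarrow> transpose M = M \<and> (\<forall>x. 0 \<le> x \<bullet> (M *v x))"

definition pos_def :: "real^'n^'n \<Rightarrow> bool" where
  "pos_def M \<longleftrightarrow> transpose M = M \<and> (\<forall>x. x \<noteq> 0 \<longrightarrow> 0 < x \<bullet> (M *v x))"

definition loewner_ge :: "real^'n^'n \<Rightarrow> real^'n^'n \<Rightarrow> bool" (infix "\<succeq>" 50) where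
  "M \<succeq> N \<longleftrightarrow> pos_semidef (M - N)"

definition diagonal :: "real^'n^'n \<Rightarrow> bool" where
  "diagonal M \<longleftrightarrow> (\<forall>i j. i \<noteq> j \<longrightarrow> M $ i $ j = 0)"

definition wnorm :: "real^'n^'n \<Rightarrow> real^'n \<Rightarrow> real" where
  "wnorm S x = sqrt (x \<bullet> (S *v x))"

definition gradient :: "('a::real_inner \<Rightarrow> real) \<Rightarrow> 'a \<Rightarrow> 'a" where
  "gradient f x = (THE D. GDERIV f x :> D)"

definition indicator_ext :: "'a set \<Rightarrow> 'a \<Rightarrow> ereal" where
  "indicator_ext C z = (if z \<in> C then 0 else \<infinity>)"

text \<open>The subdifferential of \<open>indicator_ext C\<close>, i.e. the normal cone to \<open>C\<close>.\<close>

definition subdiff_indicator :: "'a::real_inner set \<Rightarrow> 'a \<Rightarrow> 'a set" where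
  "subdiff_indicator C z = (if z \<in> C then {v. \<forall>z'\<in>C. v \<bullet> (z' - z) \<le> 0} else {})"

text \<open>\<open>0\<close> belongs to the regular subdifferential of \<open>\<phi>\<close> at \<open>x\<close>;
  the filter \<open>at x\<close> excludes the point \<open>x\<close> itself.\<close>

definition stationary :: "('a::real_normed_vector \<Rightarrow> ereal) \<Rightarrow> 'a \<Rightarrow> bool" where
  "stationary \<phi> x \<longleftrightarrow>
     \<phi> x < \<infinity> \<and> 0 \<le> Liminf (at x) (\<lambda>x'. (\<phi> x' - \<phi> x) / ereal (norm (x' - x)))"

definition R_linear :: "(nat \<Rightarrow> 'a::real_normed_vector) \<Rightarrow> bool" where
  "R_linear w \<longleftrightarrow>
     (\<exists>wstar. w \<longlonglongrightarrow> wstar \<and> (\<exists>c>0. \<exists>r. 0 < r \<and> r < 1 \<and> (\<forall>i. norm (w i - wstar) \<le> c * r ^ i)))"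

text \<open>The test deciding whether the proximal center is updated at iteration \<open>k\<close>.\<close>

definition palm_test ::
  "real^'n^'m \<Rightarrow> (nat \<Rightarrow> real^'m^'m) \<Rightarrow> (nat \<Rightarrow> real) \<Rightarrow> (nat \<Rightarrow> real^'n) \<Rightarrow> (nat \<Rightarrow> real^'m) \<Rightarrow> nat \<Rightarrow> bool"
where
  "palm_test A Sy eps x z k \<longleftrightarrow> wnorm (Sy k) (A *v x (Suc k) - z (Suc k)) \<le> eps k"

text \<open>Runs of P-ALM: \<open>Sx\<close>, \<open>Symin\<close> and \<open>Sy k\<close> are the penalty matrices and \<open>xh\<close> is the sequence
  of proximal centers. The values \<open>xh 0\<close> and \<open>y 0\<close> are the (arbitrary) starting points,
  while \<open>x 0\<close> and \<open>z 0\<close> are not constrained and play no role.\<close>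

locale palm_run =
  fixes Q :: "real^'n^'n" and q :: "real^'n" and A :: "real^'n^'m" and C :: "(real^'m) set"
    and Sx :: "real^'n^'n" and Symin :: "real^'m^'m" and Sy :: "nat \<Rightarrow> real^'m^'m"
    and \<rho> :: real and \<delta> :: "nat \<Rightarrow> real" and \<epsilon> :: "nat \<Rightarrow> real"
    and x :: "nat \<Rightarrow> real^'n" and z :: "nat \<Rightarrow> real^'m" and y :: "nat \<Rightarrow> real^'m"
    and xh :: "nat \<Rightarrow> real^'n"
  assumes rho: "0 < \<rho>" "\<rho> < 1"
    and delta_pos: "0 < \<delta> k"
    and eps_pos: "0 < \<epsilon> k"
    and Symin: "pos_def Symin"
    and Sy0: "Sy 0 \<succeq> Symin"
    and Sy_diagonal: "diagonal (Sy k)"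
    and Sx: "pos_def Sx"
    and Q_Sx: "pos_def (Q + matrix_inv Sx)"
    and z_step: "z (Suc k) = closest_point C (A *v x (Suc k) + matrix_inv (Sy k) *v y k)"
    and x_step: "norm (Q *v x (Suc k) + q
                   + transpose A *v (y k + Sy k *v (A *v x (Suc k) - z (Suc k)))
                   + matrix_inv Sx *v (x (Suc k) - xh k)) \<le> \<delta> k"
    and y_step: "y (Suc k) = y k + Sy k *v (A *v x (Suc k) - z (Suc k))"
    and test_pass: "palm_test A Sy \<epsilon> x z k \<Longrightarrow>
           xh (Suc k) = x (Suc k) \<and> Sy (Suc k) \<succeq> Symin \<and> \<epsilon> (Suc k) \<le> \<rho> * \<epsilon> k"
    and test_fail: "\<not> palm_test A Sy \<epsilon> x z k \<Longrightarrow>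
           xh (Suc k) = xh k \<and> Sy (Suc k) \<succeq> Sy k \<and> \<epsilon> (Suc k) = \<epsilon> k"
    and delta_step: "\<delta> (Suc k) \<le> \<rho> * \<delta> k"

end

theory Submission
  imports Defs
begin

text \<open>
  If the test failed forever, the center would be frozen and the iterates would be those of an inexact
  augmented Lagrangian method for a strongly convex problem. That problem has a KKT pair, and the
  distance of the dual iterates to its multiplier, measured with the inverse penalties, would decrease
  by a fixed amount in every iteration, which is impossible.

  The iterates at which the test succeeds form an inexact proximal point method: each is an exact KKT
  point of a problem whose data are perturbed by geometrically decaying vectors. Replacing the
  multipliers by others with the same image under \<open>transpose A\<close> and norm controlled by that image, and
  using Hoffman's bound for lower estimates of \<open>f\<close> at slightly infeasible points, one obtains descent
  of \<open>f\<close> up to errors proportional to the size of the iterates; this forces at most linear growth, so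
  the errors decay geometrically after all. Every iterate is close to a solution of the linear KKT
  system given by the signs of its multiplier, and \<open>f\<close> is constant on each of these finitely many
  solution sets. Hence the values of \<open>f\<close> approach their limit at a rate bounded by the squared step
  lengths, which together with the descent inequality yields the R-linear rate.
\<close>

section \<open>Systems of linear inequalities\<close>

text \<open>Three losses of control shape the argument. \<open>Q\<close> may be indefinite, so
  \<open>f\<close> decreases only because \<open>matrix_inv Sx\<close> and
  \<open>Q + matrix_inv Sx\<close> are both positive definite: averaging their quadratic forms
  leaves half of the proximal term. The multipliers come without a bound. And \<open>f\<close> is
  bounded below on the feasible set only, while the iterates lie slightly outside it. The last two
  defects cost errors that scale with the iterates, whose size is unknown before convergence is
  proved; hence the detour through linear growth, which a geometric factor still beats. Errors are
  counted per passed test: \<open>\<epsilon> k\<close> shrinks at every passed test and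
  \<open>\<delta> k\<close> in every iteration, so at the \<open>i\<close>-th passed test both are
  at most a multiple of \<open>\<rho> ^ i\<close>, however many failures lie in between. The finite
  set of values plays the part of a Kurdyka-Lojasiewicz inequality with exponent 1/2, except that
  the reference value is known only to belong to that set.\<close>

lemma multiplier_support_reduction:
  fixes T :: "real^'i \<Rightarrow> 'a::euclidean_space"
  assumes T: "linear T" and dep: "T \<nu> = 0" "\<nu> \<noteq> 0" "\<forall>i. i \<notin> J \<longrightarrow> \<nu> $ i = 0"
    and supp: "\<forall>i. i \<notin> J \<longrightarrow> \<theta> $ i = 0"
  shows "\<exists>i0\<in>J. \<exists>\<mu>. T \<mu> = T \<theta> \<and> (\<forall>i. 0 \<le> \<mu> $ i * \<theta> $ i \<and> (\<theta> $ i = 0 \<longrightarrow> \<mu> $ i = 0)) \<and> \<mu> $ i0 = 0"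
proof (cases "\<exists>i\<in>J. \<theta> $ i = 0")
  case True
  then obtain i0 where "i0 \<in> J" "\<theta> $ i0 = 0" by blast
  then show ?thesis by (intro bexI[of _ i0] exI[of _ \<theta>]) auto
next
  case False
  have "\<exists>j. \<nu> $ j \<noteq> 0" using dep(2) by (simp add: vec_eq_iff)
  then obtain j where j: "\<nu> $ j \<noteq> 0" "j \<in> J" using dep(3) by blast
  \<comment> \<open>Choosing the sign of the kernel vector makes at least one component of
    \<open>\<theta>\<close> move towards zero, so the ratio test below ranges over a nonempty
    set.\<close>
  obtain \<eta> where \<eta>: "T \<eta> = 0" "\<forall>i. i \<notin> J \<longrightarrow> \<eta> $ i = 0" "\<eta> $ j * \<theta> $ j > 0"
  proof (cases "\<nu> $ j * \<theta> $ j > 0")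
    case True
    then show ?thesis using that[of \<nu>] dep by auto
  next
    case F: False
    moreover have "\<nu> $ j * \<theta> $ j \<noteq> 0" using j False by auto
    ultimately have "\<nu> $ j * \<theta> $ j < 0" by linarith
    then have "(- \<nu>) $ j * \<theta> $ j > 0" by simp
    then show ?thesis using that[of "- \<nu>"] dep T by (auto simp: linear_neg)
  qed
  \<comment> \<open>Ratio test: when \<open>t * \<eta>\<close> is subtracted, exactly the components
    in \<open>I\<close> approach zero. The smallest ratio is the first time one of them vanishes;
    the others keep their sign.\<close>
  define I where "I = {i\<in>J. \<eta> $ i * \<theta> $ i > 0}"
  have fin: "finite I" "I \<noteq> {}" using j(2) \<eta>(3) by (auto simp: I_def)
  define t where "t = Min ((\<lambda>i. \<theta> $ i / \<eta> $ i) ` I)"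
  have "t \<in> (\<lambda>i. \<theta> $ i / \<eta> $ i) ` I" unfolding t_def using fin by (intro Min_in) auto
  then obtain i0 where i0: "i0 \<in> I" "t = \<theta> $ i0 / \<eta> $ i0" by blast
  have t_le: "t \<le> \<theta> $ i / \<eta> $ i" if "i \<in> I" for i
    unfolding t_def using fin that by (intro Min_le) auto
  have t0: "t \<ge> 0" using i0 by (auto simp: I_def zero_less_mult_iff zero_le_divide_iff)
  let ?\<mu> = "\<theta> - t *\<^sub>R \<eta>"
  have "0 \<le> ?\<mu> $ i * \<theta> $ i" for i
  proof (cases "i \<in> I")
    case True
    then have pos: "\<eta> $ i * \<theta> $ i > 0" by (simp add: I_def)
    have "t * (\<eta> $ i * \<theta> $ i) \<le> (\<theta> $ i / \<eta> $ i) * (\<eta> $ i * \<theta> $ i)"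
      using t_le[OF True] pos by (intro mult_right_mono) auto
    also have "\<dots> = \<theta> $ i * \<theta> $ i" using pos by (auto simp: field_simps)
    finally show ?thesis by (simp add: algebra_simps)
  next
    case False
    then have "\<eta> $ i * \<theta> $ i \<le> 0" using \<eta>(2) by (cases "i \<in> J") (auto simp: I_def)
    then have "t * (\<eta> $ i * \<theta> $ i) \<le> 0" using t0 by (simp add: mult_nonneg_nonpos)
    moreover have "0 \<le> \<theta> $ i * \<theta> $ i" by simp
    ultimately have "t * (\<eta> $ i * \<theta> $ i) \<le> \<theta> $ i * \<theta> $ i" by linarith
    then show ?thesis by (simp add: algebra_simps)
  qed
  moreover have "\<theta> $ i = 0 \<longrightarrow> ?\<mu> $ i = 0" for i using False \<eta>(2) by auto
  moreover have "?\<mu> $ i0 = 0" using i0 by (auto simp: I_def)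
  moreover have "T ?\<mu> = T \<theta>" using T \<eta>(1) by (simp add: linear_diff linear_scale)
  moreover have "i0 \<in> J" using i0 by (simp add: I_def)
  ultimately show ?thesis by blast
qed

text \<open>As long as the columns on the support are dependent, moving along the kernel of \<open>T\<close>
  until a component vanishes shrinks the support without changing signs; on an independent support
  \<open>T\<close> is injective.\<close>

lemma bounded_multipliers_on:
  fixes T :: "real^'i \<Rightarrow> 'a::euclidean_space" and J :: "'i set"
  assumes T: "linear T"
  shows "\<exists>\<kappa>\<ge>0. \<forall>\<theta>. (\<forall>i. i \<notin> J \<longrightarrow> \<theta> $ i = 0) \<longrightarrow>
    (\<exists>\<mu>. T \<mu> = T \<theta> \<and> (\<forall>i. 0 \<le> \<mu> $ i * \<theta> $ i \<and> (\<theta> $ i = 0 \<longrightarrow> \<mu> $ i = 0)) \<and> norm \<mu> \<le> \<kappa> * norm (T \<theta>))"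
  using finite[of J]
proof (induction J rule: finite_psubset_induct)
  case (psubset J)
  show ?case
  proof (cases "\<exists>\<nu>. T \<nu> = 0 \<and> \<nu> \<noteq> 0 \<and> (\<forall>i. i \<notin> J \<longrightarrow> \<nu> $ i = 0)")
    case False
    define V where "V = {\<theta> :: real^'i. \<forall>i. i \<notin> J \<longrightarrow> \<theta> $ i = 0}"
    have V: "subspace V" unfolding V_def subspace_def by auto
    have "\<exists>e>0. \<forall>x\<in>V. norm (T x) \<ge> e * norm x"
      using V T False by (intro injective_imp_isometric)
        (auto simp: V_def closed_subspace linear_conv_bounded_linear)
    then obtain e where e: "e > 0" "\<And>x. x \<in> V \<Longrightarrow> norm (T x) \<ge> e * norm x" by blast
    show ?thesis
    proof (intro exI[of _ "1/e"] conjI allI impI)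
      fix \<theta> :: "real^'i" assume "\<forall>i. i \<notin> J \<longrightarrow> \<theta> $ i = 0"
      then have "norm \<theta> \<le> 1 / e * norm (T \<theta>)"
        using e(2)[of \<theta>] e(1) by (simp add: V_def field_simps)
      then show "\<exists>\<mu>. T \<mu> = T \<theta> \<and> (\<forall>i. 0 \<le> \<mu> $ i * \<theta> $ i \<and> (\<theta> $ i = 0 \<longrightarrow> \<mu> $ i = 0))
          \<and> norm \<mu> \<le> 1 / e * norm (T \<theta>)"
        by (intro exI[of _ \<theta>]) auto
    qed (use e in auto)
  next
    case True
    then obtain \<nu> where \<nu>: "T \<nu> = 0" "\<nu> \<noteq> 0" "\<forall>i. i \<notin> J \<longrightarrow> \<nu> $ i = 0" by blast
    have "\<forall>i\<in>J. \<exists>\<kappa>\<ge>0. \<forall>\<theta>. (\<forall>k. k \<notin> J - {i} \<longrightarrow> \<theta> $ k = 0) \<longrightarrow>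
      (\<exists>\<mu>. T \<mu> = T \<theta> \<and> (\<forall>i. 0 \<le> \<mu> $ i * \<theta> $ i \<and> (\<theta> $ i = 0 \<longrightarrow> \<mu> $ i = 0)) \<and> norm \<mu> \<le> \<kappa> * norm (T \<theta>))"
      using psubset.IH by (metis Diff_subset Diff_iff insertI1 psubsetI)
    then obtain K where K: "\<And>i. i \<in> J \<Longrightarrow> K i \<ge> 0"
      "\<And>i \<theta>. i \<in> J \<Longrightarrow> (\<forall>k. k \<notin> J - {i} \<longrightarrow> \<theta> $ k = 0) \<Longrightarrow>
      (\<exists>\<mu>. T \<mu> = T \<theta> \<and> (\<forall>i. 0 \<le> \<mu> $ i * \<theta> $ i \<and> (\<theta> $ i = 0 \<longrightarrow> \<mu> $ i = 0)) \<and> norm \<mu> \<le> K i * norm (T \<theta>))"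
      by metis
    show ?thesis
    \<comment> \<open>The index that gets eliminated depends on \<open>\<theta>\<close>; summing the
      constants over all of \<open>J\<close> makes the bound uniform.\<close>
    proof (intro exI[of _ "sum K J"] conjI allI impI)
      show "0 \<le> sum K J" using K(1) by (simp add: sum_nonneg)
      fix \<theta> :: "real^'i" assume supp: "\<forall>i. i \<notin> J \<longrightarrow> \<theta> $ i = 0"
      obtain i0 \<mu> where \<mu>: "i0 \<in> J" "T \<mu> = T \<theta>" "\<mu> $ i0 = 0"
        "\<And>i. 0 \<le> \<mu> $ i * \<theta> $ i" "\<And>i. \<theta> $ i = 0 \<Longrightarrow> \<mu> $ i = 0"
        using multiplier_support_reduction[OF T \<nu> supp] by blast
      have "\<forall>k. k \<notin> J - {i0} \<longrightarrow> \<mu> $ k = 0" using \<mu> supp by auto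
      from K(2)[OF \<mu>(1) this] obtain \<mu>' where \<mu>': "T \<mu>' = T \<mu>" "\<And>i. 0 \<le> \<mu>' $ i * \<mu> $ i"
        "\<And>i. \<mu> $ i = 0 \<Longrightarrow> \<mu>' $ i = 0" "norm \<mu>' \<le> K i0 * norm (T \<mu>)" by blast
      \<comment> \<open>Agreement of signs is transitive only because zeros are inherited; without
        that clause a vanishing \<open>\<mu> $ i\<close> would break the chain.\<close>
      have "0 \<le> \<mu>' $ i * \<theta> $ i" for i
        using \<mu>(4)[of i] \<mu>'(2,3)[of i] by (cases "\<mu> $ i = 0") (auto simp: zero_le_mult_iff)
      moreover have "norm \<mu>' \<le> sum K J * norm (T \<theta>)"
      proof -
        have "K i0 \<le> sum K J" using K(1) \<mu>(1) by (intro member_le_sum) auto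
        then show ?thesis using \<mu>'(4) \<mu>(2) by (metis mult_right_mono norm_ge_zero order_trans)
      qed
      ultimately show "\<exists>\<mu>. T \<mu> = T \<theta> \<and> (\<forall>i. 0 \<le> \<mu> $ i * \<theta> $ i \<and> (\<theta> $ i = 0 \<longrightarrow> \<mu> $ i = 0))
          \<and> norm \<mu> \<le> sum K J * norm (T \<theta>)"
        using \<mu>' \<mu> by (intro exI[of _ \<mu>']) auto
    qed
  qed
qed

lemma bounded_multipliers:
  fixes T :: "real^'i \<Rightarrow> 'a::euclidean_space"
  assumes "linear T"
  obtains \<kappa> where "\<kappa> \<ge> 0" "\<And>\<theta>. \<exists>\<mu>. T \<mu> = T \<theta>
    \<and> (\<forall>i. 0 \<le> \<mu> $ i * \<theta> $ i \<and> (\<theta> $ i = 0 \<longrightarrow> \<mu> $ i = 0)) \<and> norm \<mu> \<le> \<kappa> * norm (T \<theta>)"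
  using bounded_multipliers_on[OF assms, of UNIV] by auto

section \<open>Normal cones of polyhedra and Hoffman's error bound\<close>

lemma convex_cone_hull_image_sum:
  fixes m :: "'i::finite \<Rightarrow> 'a::euclidean_space"
  assumes "g \<in> convex_cone hull (m ` I)"
  shows "\<exists>\<theta>. (\<forall>i. 0 \<le> \<theta> i) \<and> (\<forall>i. i \<notin> I \<longrightarrow> \<theta> i = 0) \<and> g = (\<Sum>i\<in>UNIV. \<theta> i *\<^sub>R m i)"
proof -
  define K where "K = {g. \<exists>\<theta>::'i\<Rightarrow>real. (\<forall>i. 0 \<le> \<theta> i) \<and> (\<forall>i. i \<notin> I \<longrightarrow> \<theta> i = 0) \<and> g = (\<Sum>i\<in>UNIV. \<theta> i *\<^sub>R m i)}"
  have "m ` I \<subseteq> K"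
  proof
    fix g assume "g \<in> m ` I"
    then obtain j where j: "j \<in> I" "g = m j" by blast
    have "(\<Sum>i\<in>UNIV. (if i = j then 1 else 0 :: real) *\<^sub>R m i) = (\<Sum>i\<in>UNIV. if i = j then m i else 0)"
      by (intro sum.cong) auto
    then have "(\<Sum>i\<in>UNIV. (if i = j then 1 else 0 :: real) *\<^sub>R m i) = m j" by simp
    then show "g \<in> K" using j unfolding K_def
      by (intro CollectI exI[of _ "\<lambda>i. if i = j then 1 else 0"]) auto
  qed
  moreover have "convex_cone K" unfolding convex_cone_iff
  proof (intro conjI ballI allI impI)
    show "0 \<in> K" unfolding K_def by (intro CollectI exI[of _ "\<lambda>i. 0"]) auto
  next
    fix a b assume "a \<in> K" "b \<in> K"
    then obtain \<theta> \<mu> where "\<forall>i. 0 \<le> \<theta> i" "\<forall>i. i \<notin> I \<longrightarrow> \<theta> i = (0::real)" "a = (\<Sum>i\<in>UNIV. \<theta> i *\<^sub>R m i)"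
      "\<forall>i. 0 \<le> \<mu> i" "\<forall>i. i \<notin> I \<longrightarrow> \<mu> i = (0::real)" "b = (\<Sum>i\<in>UNIV. \<mu> i *\<^sub>R m i)"
      unfolding K_def by blast
    then show "a + b \<in> K" unfolding K_def
      by (intro CollectI exI[of _ "\<lambda>i. \<theta> i + \<mu> i"]) (auto simp: sum.distrib algebra_simps)
  next
    fix a and c :: real assume "a \<in> K" "0 \<le> c"
    then obtain \<theta> where "\<forall>i. 0 \<le> \<theta> i" "\<forall>i. i \<notin> I \<longrightarrow> \<theta> i = (0::real)" "a = (\<Sum>i\<in>UNIV. \<theta> i *\<^sub>R m i)"
      unfolding K_def by blast
    then show "c *\<^sub>R a \<in> K" using \<open>0 \<le> c\<close> unfolding K_def
      by (intro CollectI exI[of _ "\<lambda>i. c * \<theta> i"]) (auto simp: scaleR_sum_right)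
  qed
  ultimately have "convex_cone hull (m ` I) \<subseteq> K" by (rule hull_minimal)
  then show ?thesis using assms unfolding K_def by blast
qed

text \<open>A form of Farkas' lemma. If \<open>g\<close> were outside the closed cone of active
  normals, a separating vector \<open>a\<close> would make \<open>- a\<close> a feasible direction
  at \<open>p\<close> along which \<open>g\<close> increases.\<close>

lemma polyhedron_normal_cone:
  fixes m :: "'i::finite \<Rightarrow> 'a::euclidean_space"
  assumes feas: "\<And>i. m i \<bullet> p \<le> b i"
    and normal: "\<And>\<xi>. (\<And>i. m i \<bullet> \<xi> \<le> b i) \<Longrightarrow> g \<bullet> (\<xi> - p) \<le> 0"
  obtains \<theta> where "\<And>i. 0 \<le> \<theta> i" "\<And>i. m i \<bullet> p \<noteq> b i \<Longrightarrow> \<theta> i = 0" "g = (\<Sum>i\<in>UNIV. \<theta> i *\<^sub>R m i)"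
proof -
  define I where "I = {i. m i \<bullet> p = b i}"
  define K where "K = convex_cone hull (m ` I)"
  have "g \<in> K"
  proof (rule ccontr)
    assume "g \<notin> K"
    moreover have "convex K" "closed K"
      unfolding K_def by (auto simp: convex_convex_cone_hull closed_convex_cone_hull)
    ultimately obtain a \<beta> where a: "a \<bullet> g < \<beta>" "\<And>k. k \<in> K \<Longrightarrow> a \<bullet> k > \<beta>"
      using separating_hyperplane_closed_point by metis
    have "0 \<in> K" unfolding K_def by (rule convex_cone_hull_contains_0)
    then have \<beta>: "\<beta> < 0" using a(2) by fastforce
    have ge0: "0 \<le> a \<bullet> k" if k: "k \<in> K" for k
    proof (rule ccontr)
      assume neg: "\<not> 0 \<le> a \<bullet> k"
      \<comment> \<open>The multiple is chosen so that its inner product with \<open>a\<close>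
        equals \<open>\<beta>\<close>, contradicting strict separation.\<close>
      have "(\<beta> / (a \<bullet> k)) *\<^sub>R k \<in> K" unfolding K_def
        using k neg \<beta> by (intro convex_cone_hull_mul) (auto simp: K_def divide_nonpos_nonpos)
      from a(2)[OF this] show False using neg by simp
    qed
    \<comment> \<open>A step length that the slack of an inactive constraint permits; the added 1
      keeps the denominator positive.\<close>
    define s where "s = (\<lambda>i. (b i - m i \<bullet> p) / (\<bar>m i \<bullet> a\<bar> + 1))"
    have s_pos: "s i > 0" if "i \<notin> I" for i
      using that feas[of i] unfolding s_def I_def by (intro divide_pos_pos) auto
    \<comment> \<open>The element 1 keeps the minimum meaningful when every constraint is
      active.\<close>
    define t where "t = Min (insert 1 (s ` (- I)))"
    have t: "t > 0" unfolding t_def using s_pos by (subst Min_gr_iff) auto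
    have ts: "t \<le> s i" if "i \<notin> I" for i unfolding t_def using that by (intro Min_le) auto
    have "m i \<bullet> (p - t *\<^sub>R a) \<le> b i" for i
    proof (cases "i \<in> I")
      case True
      then have "0 \<le> a \<bullet> m i" using ge0 by (auto simp: K_def hull_inc)
      then have "0 \<le> t * (m i \<bullet> a)" using t by (simp add: inner_commute)
      then show ?thesis using feas[of i] by (simp add: inner_diff_right)
    next
      case False
      have "- (t * (m i \<bullet> a)) \<le> t * (\<bar>m i \<bullet> a\<bar> + 1)"
      proof -
        have "- (t * (m i \<bullet> a)) = t * (- (m i \<bullet> a))" by simp
        also have "\<dots> \<le> t * (\<bar>m i \<bullet> a\<bar> + 1)" using t by (intro mult_left_mono) auto
        finally show ?thesis .
      qed
      also have "\<dots> \<le> s i * (\<bar>m i \<bullet> a\<bar> + 1)" using ts[OF False] by (intro mult_right_mono) auto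
      also have "\<dots> = b i - m i \<bullet> p" unfolding s_def by (simp add: add_nonneg_eq_0_iff)
      finally show ?thesis by (simp add: inner_diff_right)
    qed
    from normal[OF this] have "0 \<le> t * (a \<bullet> g)" by (simp add: inner_commute)
    then show False using t a(1) \<beta> by (simp add: zero_le_mult_iff)
  qed
  then show ?thesis using convex_cone_hull_image_sum[of g m I] that unfolding K_def I_def by blast
qed

text \<open>The displacement from \<open>\<xi>\<close> to its nearest feasible point is a
  nonnegative combination of active normals. With bounded multipliers, pairing this displacement
  with itself bounds its square by its length times the violation. The constant comes from the
  normals alone, so it serves every right-hand side \<open>b\<close> that is feasible.\<close>

lemma hoffman:
  fixes m :: "'i::finite \<Rightarrow> 'a::euclidean_space"
  obtains \<kappa> where "\<kappa> \<ge> 0" "\<And>b \<xi> v. \<exists>p. \<forall>i. m i \<bullet> p \<le> b i \<Longrightarrow> (\<And>i. m i \<bullet> \<xi> \<le> b i + v) \<Longrightarrow> 0 \<le> v \<Longrightarrow>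
     \<exists>p. (\<forall>i. m i \<bullet> p \<le> b i) \<and> norm (\<xi> - p) \<le> \<kappa> * v"
proof -
  define T where "T = (\<lambda>\<theta>::real^'i. \<Sum>i\<in>UNIV. \<theta> $ i *\<^sub>R m i)"
  have "linear T" unfolding T_def
    by (intro linearI) (auto simp: algebra_simps sum.distrib scaleR_sum_right)
  from bounded_multipliers[OF this] obtain \<kappa> where \<kappa>: "\<kappa> \<ge> 0" "\<And>\<theta>. \<exists>\<mu>. T \<mu> = T \<theta>
    \<and> (\<forall>i. 0 \<le> \<mu> $ i * \<theta> $ i \<and> (\<theta> $ i = 0 \<longrightarrow> \<mu> $ i = 0)) \<and> norm \<mu> \<le> \<kappa> * norm (T \<theta>)"
    by blast
  show ?thesis
  proof (rule that[of "real CARD('i) * \<kappa>"])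
    show "0 \<le> real CARD('i) * \<kappa>" using \<kappa>(1) by simp
    fix b :: "'i \<Rightarrow> real" and \<xi> v
    assume ne: "\<exists>p. \<forall>i. m i \<bullet> p \<le> b i" and viol: "\<And>i. m i \<bullet> \<xi> \<le> b i + v" and v: "0 \<le> v"
    define S where "S = {p. \<forall>i. m i \<bullet> p \<le> b i}"
    have S_Int: "S = (\<Inter>i. {p. m i \<bullet> p \<le> b i})" unfolding S_def by auto
    have S: "convex S" "closed S" "S \<noteq> {}"
      using ne unfolding S_Int by (auto intro!: convex_INT closed_INT simp: convex_halfspace_le closed_halfspace_le)
    define p where "p = closest_point S \<xi>"
    have p: "p \<in> S" unfolding p_def using S by (intro closest_point_in_set)
    have dot: "(\<xi> - p) \<bullet> (\<zeta> - p) \<le> 0" if "\<zeta> \<in> S" for \<zeta>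
      unfolding p_def using S that by (intro closest_point_dot)
    obtain \<theta> where \<theta>: "\<And>i. 0 \<le> \<theta> i" "\<And>i. m i \<bullet> p \<noteq> b i \<Longrightarrow> \<theta> i = 0" "\<xi> - p = (\<Sum>i\<in>UNIV. \<theta> i *\<^sub>R m i)"
      by (rule polyhedron_normal_cone[of m p b "\<xi> - p"]) (use p dot in \<open>auto simp: S_def\<close>)
    have T\<theta>: "T (\<chi> i. \<theta> i) = \<xi> - p" unfolding T_def \<theta>(3) by simp
    obtain \<mu> where \<mu>: "T \<mu> = \<xi> - p" "\<And>i. 0 \<le> \<mu> $ i * \<theta> i" "\<And>i. \<theta> i = 0 \<Longrightarrow> \<mu> $ i = 0"
       "norm \<mu> \<le> \<kappa> * norm (\<xi> - p)" using \<kappa>(2)[of "\<chi> i. \<theta> i"] T\<theta> by auto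
    have \<mu>_pos: "0 \<le> \<mu> $ i" for i using \<mu>(2,3)[of i] \<theta>(1)[of i] by (auto simp: zero_le_mult_iff)
    have le: "\<mu> $ i * (m i \<bullet> (\<xi> - p)) \<le> norm \<mu> * v" for i
    proof (cases "\<theta> i = 0")
      case True
      then show ?thesis using \<mu>(3) v by simp
    next
      case False
      then have "m i \<bullet> (\<xi> - p) \<le> v" using \<theta>(2)[of i] viol[of i] by (fastforce simp: inner_diff_right)
      then have "\<mu> $ i * (m i \<bullet> (\<xi> - p)) \<le> \<mu> $ i * v" using \<mu>_pos by (intro mult_left_mono)
      also have "\<dots> \<le> norm \<mu> * v" using v component_le_norm_cart[of \<mu> i] by (intro mult_right_mono) auto
      finally show ?thesis .
    qed
    have "norm (\<xi> - p) * norm (\<xi> - p) = T \<mu> \<bullet> (\<xi> - p)"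
      by (simp add: \<mu>(1) dot_square_norm power2_eq_square)
    also have "\<dots> = (\<Sum>i\<in>UNIV. \<mu> $ i * (m i \<bullet> (\<xi> - p)))" unfolding T_def by (simp add: inner_sum_left)
    also have "\<dots> \<le> (\<Sum>i\<in>(UNIV::'i set). norm \<mu> * v)" by (intro sum_mono le)
    also have "\<dots> = real CARD('i) * (norm \<mu> * v)" by simp
    also have "\<dots> \<le> real CARD('i) * ((\<kappa> * norm (\<xi> - p)) * v)"
      using \<mu>(4) v by (intro mult_left_mono mult_right_mono) auto
    finally have sq: "norm (\<xi> - p) * norm (\<xi> - p) \<le> norm (\<xi> - p) * (real CARD('i) * \<kappa> * v)"
      by (simp add: algebra_simps)
    have "norm (\<xi> - p) \<le> real CARD('i) * \<kappa> * v"
    proof (cases "norm (\<xi> - p) = 0")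
      case True
      then show ?thesis using v \<kappa>(1) by simp
    next
      case False
      then show ?thesis using sq by (simp only: mult_le_cancel_left) auto
    qed
    then show "\<exists>p. (\<forall>i. m i \<bullet> p \<le> b i) \<and> norm (\<xi> - p) \<le> real CARD('i) * \<kappa> * v"
      using p unfolding S_def by blast
  qed
qed

section \<open>Boxes and symmetric matrices\<close>

lemma inner_transpose_mult: "(transpose A *v y) \<bullet> x = y \<bullet> (A *v (x :: real^'n))"
  by (simp add: dot_lmul_matrix transpose_matrix_vector)

lemma matrix_norm_bound:
  fixes A :: "real^'n^'m"
  obtains K where "K > 0" "\<And>x. norm (A *v x) \<le> K * norm x"
  using bounded_linear.pos_bounded[OF matrix_vector_mul_bounded_linear[of A]]
  by (metis mult.commute)

lemma pos_def_lower_bound: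
  fixes M :: "real^'n^'n"
  assumes "pos_def M"
  obtains c where "c > 0" "\<And>x. c * (norm x)\<^sup>2 \<le> x \<bullet> (M *v x)"
proof -
  have "compact (sphere (0::real^'n) 1)" "sphere (0::real^'n) 1 \<noteq> {}" by auto
  moreover have "continuous_on (sphere 0 1) (\<lambda>x. x \<bullet> (M *v x))"
    by (intro continuous_intros)
  ultimately obtain e where e: "norm e = 1" "\<And>x. norm x = 1 \<Longrightarrow> e \<bullet> (M *v e) \<le> x \<bullet> (M *v x)"
    using continuous_attains_inf[of "sphere (0::real^'n) 1" "\<lambda>x. x \<bullet> (M *v x)"] by auto
  show ?thesis
  proof (rule that[of "e \<bullet> (M *v e)"])
    show "0 < e \<bullet> (M *v e)" using assms e(1) unfolding pos_def_def by (metis norm_zero zero_neq_one)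
    show "(e \<bullet> (M *v e)) * (norm x)\<^sup>2 \<le> x \<bullet> (M *v x)" for x
    proof (cases "x = 0")
      case False
      have "e \<bullet> (M *v e) \<le> (x /\<^sub>R norm x) \<bullet> (M *v (x /\<^sub>R norm x))" by (rule e(2)) (use False in simp)
      also have "\<dots> = (x \<bullet> (M *v x)) / (norm x)\<^sup>2"
        by (simp add: matrix_vector_mult_scaleR power2_eq_square divide_inverse)
      finally show ?thesis using False by (simp add: pos_le_divide_eq)
    qed simp
  qed
qed

text \<open>The trapezoidal rule is exact for quadratics. Having the gradients at both endpoints
  allows the KKT equations of both points to be substituted.\<close>

lemma symmetric_quadratic_diff:
  fixes H :: "real^'n^'n"
  assumes "transpose H = H"
  shows "(1/2 * (a \<bullet> (H *v a)) + b \<bullet> a) - (1/2 * (p \<bullet> (H *v p)) + b \<bullet> p)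
    = 1/2 * (((H *v a + b) + (H *v p + b)) \<bullet> (a - p))"
proof -
  have "(H *v a) \<bullet> p = a \<bullet> (H *v p)" using inner_transpose_mult[of H a p] assms by simp
  moreover have "((H *v a + b) + (H *v p + b)) \<bullet> (a - p)
      = a \<bullet> (H *v a) - (H *v a) \<bullet> p + a \<bullet> (H *v p) - p \<bullet> (H *v p) + 2 * (b \<bullet> a) - 2 * (b \<bullet> p)"
    by (simp only: inner_diff_right inner_add_left) (simp add: inner_commute)
  ultimately show ?thesis by simp
qed

lemma subdiff_box_iff:
  fixes l u :: "real^'m"
  assumes C: "C = {z. \<forall>i. l $ i \<le> z $ i \<and> z $ i \<le> u $ i}"
  shows "y \<in> subdiff_indicator C z \<longleftrightarrow>
    z \<in> C \<and> (\<forall>j. y $ j < 0 \<longrightarrow> z $ j = l $ j) \<and> (\<forall>j. 0 < y $ j \<longrightarrow> z $ j = u $ j)" (is "?L \<longleftrightarrow> ?R")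
proof
  assume L: ?L
  then have z: "z \<in> C" and n: "\<And>z'. z' \<in> C \<Longrightarrow> y \<bullet> (z' - z) \<le> 0"
    unfolding subdiff_indicator_def by (auto split: if_splits)
  have coord: "y $ j * (t - z $ j) \<le> 0" if "l $ j \<le> t" "t \<le> u $ j" for j t
  proof -
    have "z + (t - z $ j) *\<^sub>R axis j 1 \<in> C" using z that by (auto simp: C axis_def)
    from n[OF this] show ?thesis by (simp add: inner_axis mult.commute)
  qed
  have "z $ j = l $ j" if "y $ j < 0" for j
  proof -
    have "l $ j \<le> z $ j" "z $ j \<le> u $ j" using z by (auto simp: C)
    then show ?thesis using coord[of j "l $ j"] that by (auto simp: mult_le_0_iff)
  qed
  moreover have "z $ j = u $ j" if "0 < y $ j" for j
  proof -
    have "l $ j \<le> z $ j" "z $ j \<le> u $ j" using z by (auto simp: C)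
    then show ?thesis using coord[of j "u $ j"] that by (auto simp: mult_le_0_iff)
  qed
  ultimately show ?R using z by blast
next
  assume R: ?R
  have "y $ j * (z' $ j - z $ j) \<le> 0" if "z' \<in> C" for z' j
  proof -
    consider "y $ j < 0" | "y $ j = 0" | "0 < y $ j" by linarith
    then show ?thesis
    proof cases
      case 1
      then show ?thesis using R that by (intro mult_nonpos_nonneg) (auto simp: C)
    next
      case 3
      then show ?thesis using R that by (intro mult_nonneg_nonpos) (auto simp: C)
    qed simp
  qed
  then show ?L using R unfolding subdiff_indicator_def by (auto simp: inner_vec_def intro: sum_nonpos)
qed

text \<open>The sum type indexes the upper (\<open>Inl\<close>) and lower (\<open>Inr\<close>)
  bounds by one finite type, the format required by the polyhedral lemmas.\<close>

definition box_normal :: "'m + 'm \<Rightarrow> real^'m" where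
  "box_normal i = (case i of Inl j \<Rightarrow> axis j 1 | Inr j \<Rightarrow> - axis j 1)"

definition box_bound :: "real^'m \<Rightarrow> real^'m \<Rightarrow> 'm + 'm \<Rightarrow> real" where
  "box_bound l u i = (case i of Inl j \<Rightarrow> u $ j | Inr j \<Rightarrow> - l $ j)"

lemma box_halfspaces:
  "(\<forall>i. l $ i \<le> z $ i \<and> z $ i \<le> u $ i) \<longleftrightarrow> (\<forall>i. box_normal i \<bullet> z \<le> box_bound l u i)"
  by (auto simp: box_normal_def box_bound_def inner_axis' split_sum_all split: sum.split)

lemma quadratic_coercive_bound:
  fixes c :: real
  assumes "c > 0" "c * t\<^sup>2 \<le> a * t + b" "0 \<le> a" "0 \<le> b" "0 \<le> t"
  shows "t \<le> 1 + (a + b) / c"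
proof (cases "t \<le> 1")
  case True
  then show ?thesis using assms by (meson add_increasing2 add_nonneg_nonneg divide_nonneg_pos order_trans)
next
  case False
  then have "c * t * t \<le> (a + b) * t"
    using assms mult_left_mono[of 1 t b] by (simp add: power2_eq_square algebra_simps)
  then have "c * t \<le> a + b" using False by simp
  then have "t \<le> (a + b) / c" using assms(1) by (simp add: pos_le_divide_eq mult.commute)
  then show ?thesis by simp
qed

text \<open>Coercivity gives a minimizer. Its variational inequality puts the negative gradient into
  the normal cone of the feasible polyhedron, whose active normals provide the multiplier.\<close>

lemma strongly_convex_kkt_exists:
  fixes H :: "real^'n^'n" and A :: "real^'n^'m" and l u :: "real^'m"
  assumes C: "C = {z. \<forall>i. l $ i \<le> z $ i \<and> z $ i \<le> u $ i}"
    and feasible: "{x. A *v x \<in> C} \<noteq> {}" and H: "pos_def H"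
  obtains p y where "H *v p + b + transpose A *v y = 0" "y \<in> subdiff_indicator C (A *v p)"
proof -
  define S where "S = {x. A *v x \<in> C}"
  define h where "h = (\<lambda>x. 1/2 * (x \<bullet> (H *v x)) + b \<bullet> x)"
  have sym: "transpose H = H" using H by (simp add: pos_def_def)
  obtain c where c: "c > 0" "\<And>x. c * (norm x)\<^sup>2 \<le> x \<bullet> (H *v x)" using pos_def_lower_bound[OF H] by blast
  define mm where "mm = (\<lambda>i. transpose A *v box_normal i)"
  have S_eq: "x \<in> S \<longleftrightarrow> (\<forall>i. mm i \<bullet> x \<le> box_bound l u i)" for x
    unfolding S_def C mm_def mem_Collect_eq box_halfspaces inner_transpose_mult ..
  have S_Int: "S = (\<Inter>i. {x. mm i \<bullet> x \<le> box_bound l u i})" using S_eq by auto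
  have S: "convex S" "closed S" unfolding S_Int
    by (auto intro!: convex_INT closed_INT simp: convex_halfspace_le closed_halfspace_le)
  obtain x0 where x0: "x0 \<in> S" using feasible unfolding S_def by blast
  have cont: "continuous_on UNIV h" unfolding h_def by (intro continuous_intros)
  define K where "K = S \<inter> {x. h x \<le> h x0}"
  have "closed K" unfolding K_def using S(2) cont
    by (intro closed_Int closed_Collect_le continuous_intros) auto
  moreover have "bounded K"
  proof (rule boundedI)
    fix x assume "x \<in> K"
    then have "1/2 * (x \<bullet> (H *v x)) + b \<bullet> x \<le> h x0" by (simp add: K_def h_def)
    moreover have "- (b \<bullet> x) \<le> norm b * norm x" using Cauchy_Schwarz_ineq2[of b x] by linarith
    ultimately have "c/2 * (norm x)\<^sup>2 \<le> norm b * norm x + \<bar>h x0\<bar>" using c(2)[of x] by (simp add: field_simps)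
    then show "norm x \<le> 1 + (norm b + \<bar>h x0\<bar>) / (c/2)"
      using c(1) by (intro quadratic_coercive_bound) auto
  qed
  ultimately have "compact K" by (simp add: compact_eq_bounded_closed)
  moreover have "K \<noteq> {}" using x0 by (auto simp: K_def)
  ultimately obtain p where p: "p \<in> K" "\<And>x. x \<in> K \<Longrightarrow> h p \<le> h x"
    using continuous_attains_inf[of K h] cont continuous_on_subset by blast
  have pS: "p \<in> S" using p(1) by (simp add: K_def)
  have min: "h p \<le> h x" if "x \<in> S" for x using p that by (force simp: K_def)
  have normal: "(- (H *v p + b)) \<bullet> (x - p) \<le> 0" if x: "x \<in> S" for x
  proof -
    let ?v = "x - p"
    define \<alpha> where "\<alpha> = (H *v p + b) \<bullet> ?v"
    define \<beta> where "\<beta> = 1/2 * (?v \<bullet> (H *v ?v))"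
    \<comment> \<open>Along the segment towards \<open>x\<close> the value of \<open>h\<close>
      changes by exactly \<open>t * (\<alpha> + t * \<beta>)\<close>; the curvature term disappears
      as \<open>t\<close> tends to 0 from the right.\<close>
    have "0 \<le> \<alpha> + t * \<beta>" if t: "0 < t" "t \<le> 1" for t
    proof -
      have "p + t *\<^sub>R ?v = (1 - t) *\<^sub>R p + t *\<^sub>R x" by (simp add: algebra_simps)
      then have "p + t *\<^sub>R ?v \<in> S" using S(1) pS x t by (simp add: convex_alt)
      from min[OF this] have "0 \<le> h (p + t *\<^sub>R ?v) - h p" by simp
      also have "\<dots> = 1/2 * ((H *v (p + t *\<^sub>R ?v) + b + (H *v p + b)) \<bullet> (p + t *\<^sub>R ?v - p))"
        unfolding h_def by (rule symmetric_quadratic_diff[OF sym])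
      also have "\<dots> = 1/2 * (((H *v p + t *\<^sub>R (H *v ?v) + b) + (H *v p + b)) \<bullet> (t *\<^sub>R ?v))"
        by (simp only: matrix_vector_right_distrib matrix_vector_mult_scaleR add_diff_cancel_left')
      also have "\<dots> = t * (\<alpha> + t * \<beta>)" unfolding \<alpha>_def \<beta>_def
        by (simp only: inner_add_left inner_scaleR_left inner_scaleR_right inner_commute[of ?v])
          (simp add: field_simps)
      finally show ?thesis using t by (simp add: zero_le_mult_iff)
    qed
    then have ev: "\<forall>\<^sub>F t in at_right 0. 0 \<le> \<alpha> + t * \<beta>"
      unfolding eventually_at_right_field by (intro exI[of _ 1]) auto
    have "((\<lambda>t. \<alpha> + t * \<beta>) \<longlongrightarrow> \<alpha> + 0 * \<beta>) (at_right 0)" by (intro tendsto_intros)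
    from tendsto_lowerbound[OF this ev] have "0 \<le> \<alpha>" by simp
    then show ?thesis unfolding \<alpha>_def by (simp add: inner_diff_left inner_add_left)
  qed
  obtain \<theta> where \<theta>: "\<And>i. 0 \<le> \<theta> i" "\<And>i. mm i \<bullet> p \<noteq> box_bound l u i \<Longrightarrow> \<theta> i = 0"
      "- (H *v p + b) = (\<Sum>i\<in>UNIV. \<theta> i *\<^sub>R mm i)"
    by (rule polyhedron_normal_cone[of mm p "box_bound l u" "- (H *v p + b)"]) (use pS normal S_eq in auto)
  \<comment> \<open>The coefficients of upper and lower bounds enter with opposite signs, which
    turns the multipliers of the halfspaces into one box multiplier.\<close>
  define y where "y = (\<Sum>i\<in>UNIV. \<theta> i *\<^sub>R (box_normal i :: real^'m))"
  have "transpose A *v y = - (H *v p + b)" unfolding \<theta>(3) y_def mm_def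
    by (simp add: matrix_vector_mult_scaleR linear_sum[OF matrix_vector_mul_linear])
  then have "H *v p + b + transpose A *v y = 0" by simp
  moreover have "y \<bullet> (z - A *v p) \<le> 0" if "z \<in> C" for z
  proof -
    have "\<theta> i * (box_normal i \<bullet> (z - A *v p)) \<le> 0" for i
    proof (cases "\<theta> i = 0")
      case False
      then have "box_normal i \<bullet> (A *v p) = box_bound l u i"
        using \<theta>(2)[of i] unfolding mm_def inner_transpose_mult by blast
      moreover have "box_normal i \<bullet> z \<le> box_bound l u i" using that by (simp add: C box_halfspaces)
      ultimately show ?thesis using \<theta>(1)[of i] by (simp add: inner_diff_right mult_nonneg_nonpos)
    qed simp
    then show ?thesis unfolding y_def by (auto simp: inner_sum_left intro: sum_nonpos)
  qed
  ultimately show ?thesis using pS that[of p y] unfolding subdiff_indicator_def S_def by auto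
qed

text \<open>Since the rows of the box are signed unit vectors, the shift \<open>r\<close> accounts
  for a violation of at most \<open>norm r\<close> per row, and Hoffman's bound applies.\<close>

lemma near_feasible_projection:
  fixes A :: "real^'n^'m" and l u :: "real^'m"
  assumes C: "C = {z. \<forall>i. l $ i \<le> z $ i \<and> z $ i \<le> u $ i}"
    and feasible: "{x. A *v x \<in> C} \<noteq> {}"
  obtains \<kappa> where "\<kappa> \<ge> 0" "\<And>w r. A *v w + r \<in> C \<Longrightarrow> \<exists>p. A *v p \<in> C \<and> norm (w - p) \<le> \<kappa> * norm r"
proof -
  define mm where "mm = (\<lambda>i. transpose A *v box_normal i)"
  have S_eq: "A *v x \<in> C \<longleftrightarrow> (\<forall>i. mm i \<bullet> x \<le> box_bound l u i)" for x
    unfolding C mm_def mem_Collect_eq box_halfspaces inner_transpose_mult ..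
  obtain \<kappa> where \<kappa>: "\<kappa> \<ge> 0" "\<And>b \<xi> v. \<exists>p. \<forall>i. mm i \<bullet> p \<le> b i \<Longrightarrow> (\<And>i. mm i \<bullet> \<xi> \<le> b i + v) \<Longrightarrow> 0 \<le> v \<Longrightarrow>
     \<exists>p. (\<forall>i. mm i \<bullet> p \<le> b i) \<and> norm (\<xi> - p) \<le> \<kappa> * v"
    using hoffman[of mm] by blast
  show ?thesis
  proof (rule that[OF \<kappa>(1)])
    fix w r assume "A *v w + r \<in> C"
    then have "box_normal i \<bullet> (A *v w + r) \<le> box_bound l u i" for i by (simp add: C box_halfspaces)
    moreover have "- (box_normal i \<bullet> r) \<le> norm r" for i
      using component_le_norm_cart[of r] unfolding box_normal_def
      by (auto simp: inner_axis' abs_le_iff split: sum.split)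
    ultimately have "mm i \<bullet> w \<le> box_bound l u i + norm r" for i
      unfolding mm_def inner_transpose_mult by (smt (verit) inner_add_right)
    moreover have "\<exists>p. \<forall>i. mm i \<bullet> p \<le> box_bound l u i" using feasible S_eq by blast
    ultimately show "\<exists>p. A *v p \<in> C \<and> norm (w - p) \<le> \<kappa> * norm r"
      using \<kappa>(2)[of "box_bound l u" w "norm r"] S_eq by auto
  qed
qed

text \<open>Normality to a box depends only on the signs of the components, and these survive the
  replacement. The image under \<open>transpose A\<close> is what a stationarity residual controls,
  whereas \<open>y\<close> itself may drift along the kernel.\<close>

lemma box_multiplier_bound:
  fixes A :: "real^'n^'m" and l u :: "real^'m"
  assumes C: "C = {z. \<forall>i. l $ i \<le> z $ i \<and> z $ i \<le> u $ i}"
  obtains \<kappa> where "\<kappa> \<ge> 0" "\<And>y z. y \<in> subdiff_indicator C z \<Longrightarrow>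
    \<exists>y'\<in>subdiff_indicator C z. transpose A *v y' = transpose A *v y \<and> norm y' \<le> \<kappa> * norm (transpose A *v y)"
proof -
  obtain \<kappa> where \<kappa>: "\<kappa> \<ge> 0" "\<And>y. \<exists>y'. transpose A *v y' = transpose A *v y
    \<and> (\<forall>i. 0 \<le> y' $ i * y $ i \<and> (y $ i = 0 \<longrightarrow> y' $ i = 0)) \<and> norm y' \<le> \<kappa> * norm (transpose A *v y)"
    using bounded_multipliers[OF matrix_vector_mul_linear[of "transpose A"]] by blast
  show ?thesis
  proof (rule that[OF \<kappa>(1)])
    fix y z assume y: "y \<in> subdiff_indicator C z"
    obtain y' where y': "transpose A *v y' = transpose A *v y" "\<And>i. 0 \<le> y' $ i * y $ i"
      "\<And>i. y $ i = 0 \<Longrightarrow> y' $ i = 0" "norm y' \<le> \<kappa> * norm (transpose A *v y)" using \<kappa>(2)[of y] by blast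
    have "y $ j < 0" if "y' $ j < 0" for j
      using that y'(2,3)[of j] by (cases "y $ j = 0") (auto simp: zero_le_mult_iff)
    moreover have "0 < y $ j" if "0 < y' $ j" for j
      using that y'(2,3)[of j] by (cases "y $ j = 0") (auto simp: zero_le_mult_iff)
    ultimately have "y' \<in> subdiff_indicator C z" using y unfolding subdiff_box_iff[OF C] by blast
    then show "\<exists>y'\<in>subdiff_indicator C z. transpose A *v y' = transpose A *v y \<and> norm y' \<le> \<kappa> * norm (transpose A *v y)"
      using y' by blast
  qed
qed

text \<open>The threshold \<open>\<eta>\<close> absorbs inconsistent systems: there the residual
  stays away from zero because the range is closed, so the claim is vacuous for small
  \<open>\<eta>\<close>. In a consistent system a linear right inverse on the range supplies the
  correction.\<close>

lemma linear_system_error_bound: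
  fixes T :: "'a::euclidean_space \<Rightarrow> 'b::euclidean_space"
  assumes T: "linear T"
  obtains \<kappa> \<eta> where "\<kappa> \<ge> 0" "\<eta> > 0" "\<And>\<xi>. norm (T \<xi> - b) \<le> \<eta> \<Longrightarrow> \<exists>p. T p = b \<and> norm (\<xi> - p) \<le> \<kappa> * norm (T \<xi> - b)"
proof (cases "b \<in> range T")
  case True
  then obtain p0 where p0: "T p0 = b" by blast
  obtain g where g: "linear g" "\<forall>y\<in>range T. T (g y) = y"
    using linear_exists_right_inverse_on[OF T subspace_UNIV] by blast
  obtain \<kappa> where \<kappa>: "\<kappa> > 0" "\<And>y. norm (g y) \<le> norm y * \<kappa>"
    using bounded_linear.pos_bounded g(1) linear_conv_bounded_linear by metis
  show ?thesis
  proof (rule that[of \<kappa> 1])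
    fix \<xi>
    let ?p = "\<xi> - g (T \<xi> - b)"
    have "T \<xi> - b = T (\<xi> - p0)" using T p0 by (simp add: linear_diff)
    then have "T (g (T \<xi> - b)) = T \<xi> - b" using g(2) by auto
    then have "T ?p = b" using T by (simp add: linear_diff)
    then show "\<exists>p. T p = b \<and> norm (\<xi> - p) \<le> \<kappa> * norm (T \<xi> - b)"
      using \<kappa>(2) by (intro exI[of _ ?p]) (auto simp: mult.commute)
  qed (use \<kappa> in auto)
next
  case False
  have "closed (range T)" using T by (simp add: closed_subspace linear_subspace_image)
  then obtain e where e: "e > 0" "ball b e \<inter> range T = {}"
    using False by (metis Compl_iff closed_def disjoint_eq_subset_Compl open_contains_ball)
  then have "norm (T \<xi> - b) > e/2" for \<xi>
    using e by (smt (verit) IntI dist_norm norm_minus_commute empty_iff field_sum_of_halves mem_ball rangeI)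
  then show ?thesis using that[of 0 "e/2"] e by (metis half_gt_zero linorder_not_le order_refl)
qed

section \<open>Rates of real sequences\<close>

text \<open>By Cauchy-Schwarz the squared sum is at most \<open>i\<close> times the sum of squares,
  hence at most a multiple of \<open>i\<close> times the sum itself. Dividing once by
  \<open>N0\<close> plus the sum, which is at least 1, leaves linear growth.\<close>

lemma linear_growth_from_square_sums:
  fixes d :: "nat \<Rightarrow> real"
  assumes a: "a > 0" and K: "K \<ge> 0" and N0: "N0 \<ge> 1" and d: "\<And>i. d i \<ge> 0"
    and bound: "a * (\<Sum>j<i. (d j)\<^sup>2) \<le> K * (N0 + (\<Sum>j<i. d j))"
  shows "N0 + (\<Sum>j<i. d j) \<le> 2 * N0\<^sup>2 + 2 * (K / a) * real i"
proof -
  define S where "S = (\<Sum>j<i. d j)"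
  have S: "S \<ge> 0" unfolding S_def using d by (simp add: sum_nonneg)
  have "S\<^sup>2 \<le> real i * (\<Sum>j<i. (d j)\<^sup>2)"
    unfolding S_def using Cauchy_Schwarz_ineq_sum[of "\<lambda>_. 1" d "{..<i}"] by simp
  also have "\<dots> \<le> real i * ((K / a) * (N0 + S))"
    using bound a unfolding S_def by (intro mult_left_mono) (auto simp: field_simps)
  finally have S2: "S\<^sup>2 \<le> real i * (K / a) * (N0 + S)" by (simp add: algebra_simps)
  have "(N0 + S) * (N0 + S) \<le> 2 * N0\<^sup>2 + 2 * S\<^sup>2"
    using sum_squares_bound[of N0 S] by (simp add: power2_eq_square algebra_simps)
  also have "\<dots> \<le> 2 * N0\<^sup>2 * (N0 + S) + 2 * (real i * (K / a) * (N0 + S))"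
  proof -
    have "2 * N0\<^sup>2 * 1 \<le> 2 * N0\<^sup>2 * (N0 + S)" using N0 S by (intro mult_left_mono) auto
    then show ?thesis using S2 by linarith
  qed
  also have "\<dots> = (2 * N0\<^sup>2 + 2 * (K / a) * real i) * (N0 + S)" by (simp add: algebra_simps)
  finally show ?thesis using N0 S unfolding S_def by (subst (asm) mult_le_cancel_right) auto
qed

lemma linear_times_geometric:
  fixes \<rho> :: real
  assumes "0 < \<rho>" "\<rho> < 1"
  obtains \<sigma> K where "0 < \<sigma>" "\<sigma> < 1" "\<rho> < \<sigma>" "K > 0" "\<And>i. (1 + real i) * \<rho> ^ i \<le> K * \<sigma> ^ i"
proof -
  define \<sigma> where "\<sigma> = (1 + \<rho>) / 2"
  have \<sigma>: "0 < \<sigma>" "\<sigma> < 1" "\<rho> < \<sigma>" using assms by (auto simp: \<sigma>_def)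
  \<comment> \<open>Bernoulli's inequality for \<open>(\<sigma> / \<rho>) ^ i\<close>, whose base is
    \<open>1 + t\<close>, outgrows the linear factor.\<close>
  define t where "t = \<sigma> / \<rho> - 1"
  have t: "t > 0" using assms \<sigma> by (simp add: t_def field_simps)
  show ?thesis
  proof (rule that[OF \<sigma>, of "1 + 1 / t"])
    show "1 + 1 / t > 0" using t by (simp add: add_pos_pos)
    fix i
    have "1 + real i * t \<le> (\<sigma> / \<rho>) ^ i" using Bernoulli_inequality[of t i] t by (simp add: t_def)
    moreover have "1 + real i \<le> (1 + 1 / t) * (1 + real i * t)"
      using t by (simp add: field_simps)
    ultimately have "1 + real i \<le> (1 + 1 / t) * (\<sigma> / \<rho>) ^ i"
      using t by (meson add_nonneg_nonneg divide_nonneg_pos mult_left_mono order_trans zero_le_one)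
    then have "(1 + real i) * \<rho> ^ i \<le> (1 + 1 / t) * (\<sigma> / \<rho>) ^ i * \<rho> ^ i"
      using assms by (intro mult_right_mono) auto
    then show "(1 + real i) * \<rho> ^ i \<le> (1 + 1 / t) * \<sigma> ^ i"
      using assms by (simp add: power_divide)
  qed
qed

lemma perturbed_contraction_geometric:
  fixes E :: "nat \<Rightarrow> real"
  assumes \<theta>: "0 \<le> \<theta>" "\<theta> < 1" and \<sigma>: "0 < \<sigma>" "\<sigma> < 1"
    and step: "\<And>i. M \<le> i \<Longrightarrow> E (Suc i) \<le> \<theta> * E i + K * \<sigma> ^ i" and K: "0 \<le> K"
  obtains \<tau> B where "0 < \<tau>" "\<tau> < 1" "\<And>i. M \<le> i \<Longrightarrow> E i \<le> B * \<tau> ^ i"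
proof -
  \<comment> \<open>The rate must dominate \<open>\<sigma>\<close> and exceed
    \<open>\<theta>\<close> strictly: the gap \<open>\<tau> - \<theta>\<close> absorbs the
    perturbation in the induction, whence the second term of \<open>B\<close>.\<close>
  define \<tau> where "\<tau> = max ((1 + \<theta>) / 2) \<sigma>"
  have \<tau>: "0 < \<tau>" "\<tau> < 1" "\<theta> < \<tau>" "\<sigma> \<le> \<tau>" using \<theta> \<sigma> by (auto simp: \<tau>_def less_max_iff_disj)
  define B where "B = max (E M / \<tau> ^ M) (K / (\<tau> - \<theta>))"
  have BK: "K \<le> B * (\<tau> - \<theta>)" using \<tau> by (simp add: B_def pos_divide_le_eq[symmetric])
  have "E i \<le> B * \<tau> ^ i" if "M \<le> i" for i
    using that
  proof (induction i rule: dec_induct)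
    case base
    then show ?case using \<tau> by (simp add: B_def pos_divide_le_eq[symmetric])
  next
    case (step i)
    have "E (Suc i) \<le> \<theta> * E i + K * \<sigma> ^ i" using assms(5) step by simp
    also have "\<dots> \<le> \<theta> * (B * \<tau> ^ i) + K * \<tau> ^ i"
      using step \<theta> K \<sigma> \<tau> by (intro add_mono mult_left_mono power_mono) auto
    also have "\<dots> \<le> \<theta> * (B * \<tau> ^ i) + (B * (\<tau> - \<theta>)) * \<tau> ^ i"
      using BK \<tau> by (intro add_left_mono mult_right_mono) auto
    also have "\<dots> = B * \<tau> ^ Suc i" by (simp add: algebra_simps)
    finally show ?case .
  qed
  then show ?thesis using that \<tau> by blast
qed

text \<open>The error-bound inequality only requires the values to be close to some member of a finite
  set; since the values converge, that member is eventually their limit.\<close>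

lemma descent_finite_values_geometric:
  fixes F d :: "nat \<Rightarrow> real"
  assumes a: "a > 0" and K: "K \<ge> 0" and \<sigma>: "0 < \<sigma>" "\<sigma> < 1" and d: "\<And>i. d i \<ge> 0"
    and descent: "\<And>i. a * (d i)\<^sup>2 \<le> F i - F (Suc i) + K * \<sigma> ^ i"
    and lower: "\<And>i. B \<le> F i"
    and V: "finite V" and \<eta>: "\<eta> > 0"
    and near: "\<And>i. K * (d i + \<sigma> ^ i) \<le> \<eta> \<Longrightarrow> \<exists>c\<in>V. \<bar>F (Suc i) - c\<bar> \<le> K * ((d i)\<^sup>2 + \<sigma> ^ i)"
  obtains K' \<tau> where "0 < \<tau>" "\<tau> < 1" "\<And>i. d i \<le> K' * \<tau> ^ i"
proof -
  \<comment> \<open>The added term is the sum of all errors from index \<open>i\<close> on, so it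
    turns descent up to errors into true monotonicity.\<close>
  define \<psi> where "\<psi> = (\<lambda>i. F i + K / (1 - \<sigma>) * \<sigma> ^ i)"
  have tail: "K / (1 - \<sigma>) * \<sigma> ^ i - K / (1 - \<sigma>) * \<sigma> ^ Suc i = K * \<sigma> ^ i" for i
  proof -
    define k where "k = K / (1 - \<sigma>)"
    have "k * \<sigma> ^ i - k * \<sigma> ^ Suc i = k * (1 - \<sigma>) * \<sigma> ^ i" by (simp add: algebra_simps)
    moreover have "k * (1 - \<sigma>) = K" using \<sigma> by (simp add: k_def)
    ultimately show ?thesis by (simp add: k_def)
  qed
  have \<psi>: "a * (d i)\<^sup>2 \<le> \<psi> i - \<psi> (Suc i)" for i
    using descent[of i] tail[of i] unfolding \<psi>_def by linarith
  have dec: "decseq \<psi>"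
  proof (rule decseq_SucI)
    fix i
    have "0 \<le> a * (d i)\<^sup>2" using a by simp
    then show "\<psi> (Suc i) \<le> \<psi> i" using \<psi>[of i] by linarith
  qed
  have pow0: "(\<lambda>i. \<sigma> ^ i) \<longlonglongrightarrow> 0" using \<sigma> by (intro LIMSEQ_power_zero) auto
  have "B \<le> \<psi> i" for i
  proof -
    have "0 \<le> K / (1 - \<sigma>) * \<sigma> ^ i" using K \<sigma> by simp
    then show ?thesis using lower[of i] unfolding \<psi>_def by linarith
  qed
  then obtain L where L: "\<psi> \<longlonglongrightarrow> L" "\<And>i. L \<le> \<psi> i" using decseq_convergent[OF dec] by metis
  have diff0: "(\<lambda>i. \<psi> i - \<psi> (Suc i)) \<longlonglongrightarrow> 0" using tendsto_diff[OF L(1) LIMSEQ_Suc[OF L(1)]] by simp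
  have F_lim: "F \<longlonglongrightarrow> L"
  proof -
    have "(\<lambda>i. \<psi> i - K / (1 - \<sigma>) * \<sigma> ^ i) \<longlonglongrightarrow> L - K / (1 - \<sigma>) * 0" by (intro tendsto_intros L pow0)
    then show ?thesis by (simp add: \<psi>_def)
  qed
  have d2: "(\<lambda>i. (d i)\<^sup>2) \<longlonglongrightarrow> 0"
  proof (rule tendsto_sandwich[where f = "\<lambda>_. 0" and h = "\<lambda>i. (\<psi> i - \<psi> (Suc i)) / a"])
    show "\<forall>\<^sub>F i in sequentially. (d i)\<^sup>2 \<le> (\<psi> i - \<psi> (Suc i)) / a"
      using \<psi> a by (intro always_eventually allI) (simp add: pos_le_divide_eq mult.commute)
    show "(\<lambda>i. (\<psi> i - \<psi> (Suc i)) / a) \<longlonglongrightarrow> 0" using tendsto_divide[OF diff0 tendsto_const[of a]] a by simp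
  qed (auto intro: always_eventually)
  then have "(\<lambda>i. sqrt ((d i)\<^sup>2)) \<longlonglongrightarrow> 0" using tendsto_real_sqrt by fastforce
  then have d0: "d \<longlonglongrightarrow> 0" using d by simp
  define s where "s = (\<lambda>i. K * ((d i)\<^sup>2 + \<sigma> ^ i))"
  have s0: "s \<longlonglongrightarrow> 0"
  proof -
    have "s \<longlonglongrightarrow> K * (0 + 0)" unfolding s_def by (intro tendsto_intros d2 pow0)
    then show ?thesis by simp
  qed
  \<comment> \<open>A gap around the limit: once \<open>F (Suc i)\<close> is within
    \<open>g/2\<close> of \<open>L\<close> and the error is below \<open>g/2\<close>, the member of
    \<open>V\<close> supplied by \<open>near\<close> can only be \<open>L\<close>.\<close>
  obtain g where g: "g > 0" "\<And>c. c \<in> V \<Longrightarrow> c \<noteq> L \<Longrightarrow> g \<le> dist L c"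
    using finite_set_avoid[OF V, of L] by blast
  have "(\<lambda>i. K * (d i + \<sigma> ^ i)) \<longlonglongrightarrow> K * (0 + 0)" by (intro tendsto_intros d0 pow0)
  then have "\<forall>\<^sub>F i in sequentially. K * (d i + \<sigma> ^ i) < \<eta>" using \<eta> by (intro order_tendstoD) auto
  moreover have "\<forall>\<^sub>F i in sequentially. \<bar>F (Suc i) - L\<bar> < g/2"
    using tendstoD[OF LIMSEQ_Suc[OF F_lim], of "g/2"] g(1) by (simp add: dist_real_def)
  moreover have "\<forall>\<^sub>F i in sequentially. s i < g/2" using s0 g(1) by (intro order_tendstoD) auto
  ultimately have "\<forall>\<^sub>F i in sequentially. F (Suc i) - L \<le> s i"
  proof eventually_elim
    case (elim i)
    then obtain c where c: "c \<in> V" "\<bar>F (Suc i) - c\<bar> \<le> s i" using near[of i] unfolding s_def by auto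
    have "\<bar>L - c\<bar> < g" using elim c(2) by linarith
    then have "dist L c < g" by (simp add: dist_real_def)
    then have "c = L" using g(2)[OF c(1)] by fastforce
    then show ?case using c(2) by simp
  qed
  then obtain M where M: "\<And>i. M \<le> i \<Longrightarrow> F (Suc i) - L \<le> s i" unfolding eventually_sequentially by blast
  define E where "E = (\<lambda>i. \<psi> i - L)"
  define K2 where "K2 = K + K / (1 - \<sigma>)"
  \<comment> \<open>Descent bounds \<open>K * (d i)\<^sup>2\<close> by
    \<open>k * (E i - E (Suc i))\<close>. Moving \<open>E (Suc i)\<close> to the left yields the
    contraction factor \<open>k / (1 + k)\<close>.\<close>
  define k where "k = K / a"
  have k: "k \<ge> 0" using K a by (simp add: k_def)
  have E_step: "E (Suc i) \<le> (k / (1 + k)) * E i + (K2 / (1 + k)) * \<sigma> ^ i" if i: "M \<le> i" for i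
  proof -
    have "K / (1 - \<sigma>) * \<sigma> ^ Suc i \<le> K / (1 - \<sigma>) * \<sigma> ^ i"
      using K \<sigma> by (intro mult_left_mono power_decreasing) auto
    moreover have "K * (d i)\<^sup>2 \<le> k * (E i - E (Suc i))"
      using mult_left_mono[OF \<psi>[of i] k] a by (simp add: k_def E_def)
    ultimately have "E (Suc i) \<le> k * (E i - E (Suc i)) + K2 * \<sigma> ^ i"
      using M[OF i] unfolding E_def s_def K2_def \<psi>_def by (simp add: algebra_simps)
    then have "(1 + k) * E (Suc i) \<le> k * E i + K2 * \<sigma> ^ i" by (simp add: algebra_simps)
    then have "E (Suc i) \<le> (k * E i + K2 * \<sigma> ^ i) / (1 + k)"
      using k by (simp add: pos_le_divide_eq mult.commute)
    then show ?thesis by (simp add: add_divide_distrib)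
  qed
  obtain \<tau> B' where \<tau>: "0 < \<tau>" "\<tau> < 1" "\<And>i. M \<le> i \<Longrightarrow> E i \<le> B' * \<tau> ^ i"
  proof (rule perturbed_contraction_geometric[of "k / (1 + k)" \<sigma> M E "K2 / (1 + k)"])
    show "0 \<le> K2 / (1 + k)" using K \<sigma> k by (simp add: K2_def)
  qed (use k \<sigma> E_step in auto)
  \<comment> \<open>The sum covers the finitely many indices below \<open>M\<close>, so the estimate
    holds from index 0 on. The rate becomes \<open>sqrt \<tau>\<close> since only
    \<open>(d i)\<^sup>2\<close> is bounded by \<open>E i\<close>.\<close>
  define D where "D = \<bar>B'\<bar> / a + (\<Sum>j<M. (d j)\<^sup>2 / \<tau> ^ j)"
  have D: "(d i)\<^sup>2 \<le> D * \<tau> ^ i" for i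
  proof (cases "M \<le> i")
    case True
    have "a * (d i)\<^sup>2 \<le> E i" using \<psi>[of i] L(2)[of "Suc i"] by (simp add: E_def)
    also have "\<dots> \<le> B' * \<tau> ^ i" using \<tau> True by simp
    also have "\<dots> \<le> \<bar>B'\<bar> * \<tau> ^ i" using \<tau> by (intro mult_right_mono) auto
    finally have "(d i)\<^sup>2 \<le> \<bar>B'\<bar> / a * \<tau> ^ i" using a by (simp add: field_simps)
    also have "\<dots> \<le> D * \<tau> ^ i" unfolding D_def using \<tau> by (intro mult_right_mono) (auto intro: sum_nonneg)
    finally show ?thesis .
  next
    case False
    have "(d i)\<^sup>2 / \<tau> ^ i \<le> (\<Sum>j<M. (d j)\<^sup>2 / \<tau> ^ j)"
      using False \<tau> by (intro member_le_sum) auto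
    also have "\<dots> \<le> D" using a by (simp add: D_def)
    finally show ?thesis using \<tau> by (simp add: pos_divide_le_eq)
  qed
  show ?thesis
  proof (rule that[of "sqrt \<tau>" "sqrt D"])
    fix i
    have "d i = sqrt ((d i)\<^sup>2)" using d by simp
    also have "\<dots> \<le> sqrt (D * \<tau> ^ i)" using D by (intro real_sqrt_le_mono)
    also have "\<dots> = sqrt D * sqrt \<tau> ^ i" by (simp add: real_sqrt_mult real_sqrt_power)
    finally show "d i \<le> sqrt D * sqrt \<tau> ^ i" .
  qed (use \<tau> in auto)
qed

lemma geometric_steps_R_linear:
  fixes w :: "nat \<Rightarrow> 'a::banach"
  assumes \<tau>: "0 < \<tau>" "\<tau> < 1" and step: "\<And>i. norm (w (Suc i) - w i) \<le> K * \<tau> ^ i"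
  shows "R_linear w"
proof -
  have g: "summable (\<lambda>i. K * \<tau> ^ i)" using \<tau> by (intro summable_mult summable_geometric) auto
  have sn: "summable (\<lambda>i. norm (w (Suc i) - w i))"
    by (rule summable_comparison_test'[OF g, of 0]) (use step in auto)
  have K: "K \<ge> 0" using order_trans[OF norm_ge_zero step[of 0]] by simp
  have "summable (\<lambda>i. w (Suc i) - w i)" using sn by (rule summable_norm_cancel)
  then have "(\<lambda>n. \<Sum>i<n. w (Suc i) - w i) \<longlonglongrightarrow> (\<Sum>i. w (Suc i) - w i)" by (rule summable_LIMSEQ)
  then have "(\<lambda>n. w n - w 0) \<longlonglongrightarrow> (\<Sum>i. w (Suc i) - w i)" by (simp add: sum_lessThan_telescope)
  then have "(\<lambda>n. w n - w 0 + w 0) \<longlonglongrightarrow> (\<Sum>i. w (Suc i) - w i) + w 0" by (intro tendsto_intros)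
  then obtain ws where ws: "w \<longlonglongrightarrow> ws" by auto
  \<comment> \<open>The added 1 ensures a positive constant even when \<open>K\<close> is
    zero.\<close>
  define c where "c = K / (1 - \<tau>) + 1"
  have "norm (w i - ws) \<le> c * \<tau> ^ i" for i
  proof -
    have fin: "norm (w i - w (i + n)) \<le> K / (1 - \<tau>) * \<tau> ^ i" for n
    proof -
      have "norm (w i - w (i + n)) \<le> K / (1 - \<tau>) * (\<tau> ^ i - \<tau> ^ (i + n))"
      proof (induction n)
        case (Suc n)
        have "norm (w i - w (i + Suc n)) \<le> norm (w i - w (i + n)) + norm (w (i + Suc n) - w (i + n))"
          by (metis norm_minus_commute norm_triangle_ineq diff_add_cancel add_diff_eq)
        also have "\<dots> \<le> K / (1 - \<tau>) * (\<tau> ^ i - \<tau> ^ (i + n)) + K * \<tau> ^ (i + n)"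
          using Suc step[of "i + n"] by simp
        also have "\<dots> = K / (1 - \<tau>) * (\<tau> ^ i - \<tau> ^ (i + n)) + K / (1 - \<tau>) * ((1 - \<tau>) * \<tau> ^ (i + n))"
          using \<tau> by simp
        also have "\<dots> = K / (1 - \<tau>) * (\<tau> ^ i - \<tau> ^ (i + Suc n))" by (simp add: algebra_simps)
        finally show ?case .
      qed simp
      also have "\<dots> \<le> K / (1 - \<tau>) * \<tau> ^ i" using K \<tau> by (intro mult_left_mono) auto
      finally show ?thesis .
    qed
    have "(\<lambda>n. norm (w i - w (i + n))) \<longlonglongrightarrow> norm (w i - ws)"
      using LIMSEQ_ignore_initial_segment[OF ws, of i] by (intro tendsto_intros) (simp add: add.commute)
    then have "norm (w i - ws) \<le> K / (1 - \<tau>) * \<tau> ^ i"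
      by (rule LIMSEQ_le_const2) (use fin in blast)
    also have "\<dots> \<le> c * \<tau> ^ i" unfolding c_def using \<tau> by (intro mult_right_mono) auto
    finally show ?thesis .
  qed
  moreover have "c > 0" unfolding c_def using K \<tau> by (intro add_nonneg_pos) auto
  ultimately show ?thesis unfolding R_linear_def using ws \<tau> by blast
qed

section \<open>The inexact proximal point method for box-constrained quadratic programs\<close>

locale box_qp =
  fixes Q :: "real^'n^'n" and q :: "real^'n" and A :: "real^'n^'m" and l u :: "real^'m"
    and C :: "(real^'m) set" and f :: "real^'n \<Rightarrow> real"
  assumes Q_sym: "transpose Q = Q"
    and C_def: "C = {z. \<forall>i. l $ i \<le> z $ i \<and> z $ i \<le> u $ i}"
    and f_def: "f = (\<lambda>x. 1/2 * (x \<bullet> (Q *v x)) + q \<bullet> x)"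
    and feasible: "{x. A *v x \<in> C} \<noteq> {}"
    and lower_bounded: "bdd_below (f ` {x. A *v x \<in> C})"
begin

section \<open>Calculus of the quadratic objective and stationarity\<close>

lemma f_diff: "f a - f b = 1/2 * (((Q *v a + q) + (Q *v b + q)) \<bullet> (a - b))"
  unfolding f_def by (rule symmetric_quadratic_diff[OF Q_sym])

lemma f_expand: "f a - f b = (Q *v b + q) \<bullet> (a - b) + 1/2 * ((a - b) \<bullet> (Q *v (a - b)))"
proof -
  have "Q *v a = Q *v b + Q *v (a - b)" by (simp flip: matrix_vector_right_distrib)
  then show ?thesis unfolding f_diff
    by (simp only: inner_add_left inner_commute[of "a - b"]) (simp add: field_simps)
qed

text \<open>Since \<open>gradient\<close> is a definite description, differentiability alone is not
  enough: uniqueness of the derivative has to be supplied as well.\<close>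

lemma gradient_f: "gradient f x = Q *v x + q"
proof -
  obtain K where K: "K > 0" "\<And>x. norm (Q *v x) \<le> K * norm x" using matrix_norm_bound[of Q] by blast
  have "GDERIV f x :> Q *v x + q"
    unfolding gderiv_def
  proof (rule has_derivativeI_sandwich[of 1])
    show "bounded_linear (\<lambda>h. h \<bullet> (Q *v x + q))" by (rule bounded_linear_inner_left)
    show "norm (f y - f x - (y - x) \<bullet> (Q *v x + q)) / norm (y - x) \<le> K * norm (y - x)"
      if "y \<noteq> x" "dist y x < 1" for y
    proof -
      have "\<bar>(y - x) \<bullet> (Q *v (y - x))\<bar> \<le> norm (y - x) * (K * norm (y - x))"
        using Cauchy_Schwarz_ineq2[of "y - x" "Q *v (y - x)"] K(2)[of "y - x"]
        by (meson mult_left_mono norm_ge_zero order_trans)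
      moreover have "0 \<le> norm (y - x) * (K * norm (y - x))" using K by simp
      ultimately have "\<bar>f y - f x - (y - x) \<bullet> (Q *v x + q)\<bar> \<le> norm (y - x) * (K * norm (y - x))"
        unfolding f_expand[of y x] by (simp add: inner_commute)
      then show ?thesis using that by (simp add: pos_divide_le_eq mult.commute)
    qed
    have "((\<lambda>y. K * norm (y - x)) \<longlongrightarrow> K * norm (x - x)) (at x)" by (intro tendsto_intros)
    then show "((\<lambda>y. K * norm (y - x)) \<longlongrightarrow> 0) (at x)" by simp
  qed simp
  moreover have "D = D'" if "GDERIV f x :> D" "GDERIV f x :> D'" for D D'
  proof -
    have "(\<lambda>h. h \<bullet> D) = (\<lambda>h. h \<bullet> D')" using that unfolding gderiv_def by (rule has_derivative_unique)
    then show ?thesis using vector_eq_ldot by metis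
  qed
  ultimately show ?thesis unfolding gradient_def by blast
qed

text \<open>The variational inequality makes the first-order term nonnegative. The second-order term
  may be negative but is quadratic in the distance, so its quotient tends to zero; infeasible points
  have quotient \<infinity>.\<close>

lemma variational_inequality_stationary:
  assumes feas: "A *v xs \<in> C"
    and vi: "\<And>x. A *v x \<in> C \<Longrightarrow> 0 \<le> (Q *v xs + q) \<bullet> (x - xs)"
  shows "stationary (\<lambda>x. ereal (f x) + indicator_ext C (A *v x)) xs"
proof -
  let ?\<phi> = "\<lambda>x. ereal (f x) + indicator_ext C (A *v x)"
  obtain K where K: "K > 0" "\<And>x. norm (Q *v x) \<le> K * norm x" using matrix_norm_bound[of Q] by blast
  have xs: "?\<phi> xs = ereal (f xs)" using feas by (simp add: indicator_ext_def)
  have low: "ereal (- K * norm (x - xs)) \<le> (?\<phi> x - ?\<phi> xs) / ereal (norm (x - xs))" if "x \<noteq> xs" for x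
  proof (cases "A *v x \<in> C")
    case True
    have "\<bar>(x - xs) \<bullet> (Q *v (x - xs))\<bar> \<le> norm (x - xs) * (K * norm (x - xs))"
      using Cauchy_Schwarz_ineq2[of "x - xs" "Q *v (x - xs)"] K(2)[of "x - xs"]
      by (meson mult_left_mono norm_ge_zero order_trans)
    moreover have "0 \<le> norm (x - xs) * (K * norm (x - xs))" using K by simp
    ultimately have "- (norm (x - xs) * (K * norm (x - xs))) \<le> f x - f xs"
      unfolding f_expand[of x xs] using vi[OF True] by linarith
    then have "- K * norm (x - xs) \<le> (f x - f xs) / norm (x - xs)"
      using that by (simp add: pos_le_divide_eq mult_ac)
    then show ?thesis using True that unfolding xs by (simp add: indicator_ext_def)
  next
    case False
    then show ?thesis using that unfolding xs by (simp add: indicator_ext_def)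
  qed
  have lim: "((\<lambda>x. - K * norm (x - xs)) \<longlongrightarrow> - K * norm (xs - xs)) (at xs)" by (intro tendsto_intros)
  have "0 \<le> Liminf (at xs) (\<lambda>x. (?\<phi> x - ?\<phi> xs) / ereal (norm (x - xs)))"
    unfolding le_Liminf_iff
  proof (intro allI impI)
    fix c :: ereal assume c: "c < 0"
    then obtain b where b: "c < ereal b" "b < 0" by (metis ereal_dense2 ereal_less(2) zero_ereal_def less_ereal.simps(1))
    have "\<forall>\<^sub>F x in at xs. b < - K * norm (x - xs)" using lim b(2) by (intro order_tendstoD) auto
    moreover have "\<forall>\<^sub>F x in at xs. x \<noteq> xs" by (simp add: eventually_at_filter)
    ultimately show "\<forall>\<^sub>F x in at xs. c < (?\<phi> x - ?\<phi> xs) / ereal (norm (x - xs))"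
    proof eventually_elim
      case (elim x)
      have "c < ereal (- K * norm (x - xs))" using b(1) elim by (metis less_ereal.simps(1) order_less_trans)
      then show ?case using low[OF elim(2)] by (rule order_less_le_trans)
    qed
  qed
  then show ?thesis unfolding stationary_def using xs by simp
qed

text \<open>For \<open>s = 0\<close> and \<open>r = 0\<close> this says that \<open>f\<close> is constant on the KKT points with multipliers
  supported on \<open>W\<close> and prescribed values of the constraints in \<open>W\<close>.\<close>

lemma same_pattern_value_diff:
  fixes W :: "'m set"
  assumes "Q *v x + q + transpose A *v y = s"
    and "\<And>j. j \<in> W \<Longrightarrow> (A *v x + r) $ j = \<beta> $ j" and "\<And>j. j \<notin> W \<Longrightarrow> y $ j = 0"
    and "Q *v x' + q + transpose A *v y' = 0"
    and "\<And>j. j \<in> W \<Longrightarrow> (A *v x') $ j = \<beta> $ j" and "\<And>j. j \<notin> W \<Longrightarrow> y' $ j = 0"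
  shows "f x - f x' = 1/2 * (s \<bullet> (x - x') + (y + y') \<bullet> r)"
proof -
  \<comment> \<open>Complementarity with a shared support: outside \<open>W\<close> both multipliers
    vanish, and inside \<open>W\<close> the two constraint values differ only by
    \<open>r\<close>.\<close>
  have comp: "(y + y') $ j * (A *v (x - x')) $ j = - ((y + y') $ j * r $ j)" for j
  proof (cases "j \<in> W")
    case True
    then have "(A *v (x - x')) $ j = - r $ j"
      using assms(2,5)[of j] by (simp add: matrix_vector_mult_diff_distrib)
    then show ?thesis by simp
  next
    case False
    then show ?thesis using assms(3,6)[of j] by simp
  qed
  have Av: "(y + y') \<bullet> (A *v (x - x')) = - ((y + y') \<bullet> r)"
    unfolding inner_vec_def by (simp only: inner_real_def comp sum_negf)
  have "(Q *v x + q) + (Q *v x' + q) = s - transpose A *v (y + y')"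
  proof -
    have "Q *v x + q = s - transpose A *v y" using assms(1) by (simp only: eq_diff_eq)
    moreover have "Q *v x' + q = - (transpose A *v y')" using assms(4) by (simp only: eq_neg_iff_add_eq_0)
    ultimately show ?thesis by (simp only: matrix_vector_right_distrib) (simp add: algebra_simps)
  qed
  then show ?thesis unfolding f_diff
    by (simp only: inner_diff_left inner_transpose_mult Av) simp
qed

text \<open>Sign conditions and inactive constraints are deliberately dropped from the KKT system of an
  active pattern: what remains is an affine system, so its error bound is plain linear algebra, and
  \<open>f\<close> is still constant on its solution set.\<close>

definition pattern_map :: "'m set \<Rightarrow> (real^'n) \<times> (real^'m) \<Rightarrow> (real^'n) \<times> (real^'m)" where
  "pattern_map W = (\<lambda>(x, y). (Q *v x + transpose A *v y, \<chi> j. if j \<in> W then (A *v x) $ j else y $ j))"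

text \<open>An index in both sets would receive the lower bound; the negative and positive index
  sets of a multiplier never overlap.\<close>

definition pattern_rhs :: "'m set \<Rightarrow> 'm set \<Rightarrow> (real^'n) \<times> (real^'m)" where
  "pattern_rhs L U = (- q, \<chi> j. if j \<in> L then l $ j else if j \<in> U then u $ j else 0)"

lemma linear_pattern_map: "linear (pattern_map W)"
proof (rule linearI)
  show "pattern_map W (a + b) = pattern_map W a + pattern_map W b" for a b
    by (cases a; cases b) (simp add: pattern_map_def matrix_vector_right_distrib vec_eq_iff algebra_simps)
  show "pattern_map W (c *\<^sub>R b) = c *\<^sub>R pattern_map W b" for c b
    by (cases b) (simp add: pattern_map_def matrix_vector_mult_scaleR scaleR_add_right vec_eq_iff
      del: transpose_matrix_vector)
qed

lemma pattern_map_eq_rhs: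
  assumes "pattern_map (L \<union> U) (x, y) = pattern_rhs L U"
  shows "Q *v x + q + transpose A *v y = 0"
    and "\<And>j. j \<in> L \<union> U \<Longrightarrow> (A *v x) $ j = snd (pattern_rhs L U) $ j"
    and "\<And>j. j \<notin> L \<union> U \<Longrightarrow> y $ j = 0"
  using assms unfolding pattern_map_def pattern_rhs_def
  by (auto simp: vec_eq_iff algebra_simps eq_neg_iff_add_eq_0 split: if_splits)

text \<open>The error bound gives an exact solution of the pattern system near the KKT pair, and
  \<open>f\<close> takes the value \<open>c\<close> there. Both the residual and the distance are of
  order \<open>t\<close>, so the difference of the values is quadratic, apart from the pairing of
  multiplier and infeasibility.\<close>

lemma pattern_value_bound:
  obtains \<kappa> \<eta> c where "\<kappa> \<ge> 0" "\<eta> > 0" "\<And>x y r. y \<in> subdiff_indicator C (A *v x + r) \<Longrightarrow>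
      L = {j. y $ j < 0} \<Longrightarrow> U = {j. 0 < y $ j} \<Longrightarrow>
      norm (Q *v x + q + transpose A *v y) + norm r \<le> \<eta> \<Longrightarrow>
      \<bar>f x - c\<bar> \<le> \<kappa> * (norm (Q *v x + q + transpose A *v y) + norm r)\<^sup>2 + norm y * norm r"
proof -
  define T where "T = pattern_map (L \<union> U)"
  define b where "b = pattern_rhs L U"
  obtain \<kappa> \<eta> where \<kappa>: "\<kappa> \<ge> 0" "\<eta> > 0"
    "\<And>\<xi>. norm (T \<xi> - b) \<le> \<eta> \<Longrightarrow> \<exists>p. T p = b \<and> norm (\<xi> - p) \<le> \<kappa> * norm (T \<xi> - b)"
    using linear_system_error_bound[OF linear_pattern_map[of "L \<union> U"], of b] unfolding T_def by blast
  \<comment> \<open>Any solution may serve as reference. If none exists, \<open>p0\<close> is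
    arbitrary, but then no residual is as small as \<open>\<eta>\<close>.\<close>
  define p0 where "p0 = (SOME p. T p = b)"
  show ?thesis
  proof (rule that[of \<kappa> \<eta> "f (fst p0)"])
    fix x y r
    assume y: "y \<in> subdiff_indicator C (A *v x + r)" and L: "L = {j. y $ j < 0}" and U: "U = {j. 0 < y $ j}"
    define s where "s = Q *v x + q + transpose A *v y"
    define t where "t = norm s + norm r"
    assume "norm (Q *v x + q + transpose A *v y) + norm r \<le> \<eta>"
    then have t\<eta>: "t \<le> \<eta>" by (simp add: t_def s_def)
    have act: "(A *v x + r) $ j = snd b $ j" if "j \<in> L \<union> U" for j
      using y that unfolding subdiff_box_iff[OF C_def] b_def pattern_rhs_def by (auto simp: L U)
    have off: "y $ j = 0" if "j \<notin> L \<union> U" for j using that unfolding L U by auto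
    define m where "m = (\<chi> j. if j \<in> L \<union> U then - r $ j else 0)"
    have off_b: "snd b $ j = 0" if "j \<notin> L \<union> U" for j using that by (simp add: b_def pattern_rhs_def)
    have "T (x, y) - b = (s, m)"
    proof (rule prod_eqI)
      show "fst (T (x, y) - b) = fst (s, m)"
        by (simp add: T_def b_def pattern_map_def pattern_rhs_def s_def algebra_simps)
      have "snd (T (x, y) - b) $ j = m $ j" for j
        using act[of j] off[of j] off_b[of j]
        by (cases "j \<in> L \<union> U") (simp_all add: T_def pattern_map_def m_def)
      then show "snd (T (x, y) - b) = snd (s, m)" by (simp add: vec_eq_iff)
    qed
    moreover have "norm m \<le> norm r" unfolding m_def by (rule norm_le_componentwise_cart) simp
    ultimately have res: "norm (T (x, y) - b) \<le> t" using norm_Pair_le[of s m] unfolding t_def by simp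
    then obtain p where p: "T p = b" "norm ((x, y) - p) \<le> \<kappa> * norm (T (x, y) - b)" using \<kappa>(3)[of "(x, y)"] t\<eta> by (meson order_trans)
    obtain x' y' where p_eq: "p = (x', y')" by (cases p)
    have \<kappa>t: "norm (x - x') \<le> \<kappa> * t" "norm (y - y') \<le> \<kappa> * t"
    proof -
      have "norm ((x, y) - p) \<le> \<kappa> * t" using p(2) res \<kappa>(1) by (meson mult_left_mono order_trans)
      then show "norm (x - x') \<le> \<kappa> * t" "norm (y - y') \<le> \<kappa> * t" unfolding p_eq
        using norm_fst_le[of "x - x'" "y - y'"] norm_snd_le[of "y - y'" "x - x'"] by auto
    qed
    have Tp': "pattern_map (L \<union> U) (x', y') = pattern_rhs L U" using p(1) by (simp add: T_def b_def p_eq)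
    have p0: "T p0 = b" unfolding p0_def using p(1) by (rule someI)
    have Tp0: "pattern_map (L \<union> U) (fst p0, snd p0) = pattern_rhs L U" using p0 by (simp add: T_def b_def)
    have "f x' - f (fst p0) = 1/2 * (0 \<bullet> (x' - fst p0) + (y' + snd p0) \<bullet> 0)"
      by (rule same_pattern_value_diff[where W = "L \<union> U" and \<beta> = "snd b"])
        (use pattern_map_eq_rhs[OF Tp'] pattern_map_eq_rhs[OF Tp0] in \<open>auto simp: b_def\<close>)
    then have const: "f x' = f (fst p0)" by simp
    have "f x - f x' = 1/2 * (s \<bullet> (x - x') + (y + y') \<bullet> r)"
      by (rule same_pattern_value_diff[where W = "L \<union> U" and \<beta> = "snd b"])
        (use pattern_map_eq_rhs[OF Tp'] act off in \<open>auto simp: b_def s_def\<close>)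
    moreover have "\<bar>s \<bullet> (x - x')\<bar> \<le> \<kappa> * t * t"
    proof -
      have "\<bar>s \<bullet> (x - x')\<bar> \<le> norm s * norm (x - x')" by (rule Cauchy_Schwarz_ineq2)
      also have "\<dots> \<le> t * (\<kappa> * t)" using \<kappa>t by (intro mult_mono) (auto simp: t_def)
      finally show ?thesis by (simp add: algebra_simps)
    qed
    moreover have "\<bar>(y + y') \<bullet> r\<bar> \<le> 2 * (norm y * norm r) + \<kappa> * t * t"
    proof -
      \<comment> \<open>Only \<open>y' - y\<close> is controlled, so \<open>y'\<close> is traded for
        \<open>y\<close>; this produces the term \<open>norm y * norm r\<close> of the
        bound.\<close>
      have "y + y' = 2 *\<^sub>R y - (y - y')" by (simp add: scaleR_2)
      then have "norm (y + y') \<le> 2 * norm y + norm (y - y')" by (metis norm_scaleR norm_triangle_ineq4 abs_numeral)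
      also have "\<dots> \<le> 2 * norm y + \<kappa> * t" using \<kappa>t by simp
      finally have "norm (y + y') * norm r \<le> (2 * norm y + \<kappa> * t) * norm r" by (intro mult_right_mono) auto
      moreover have "\<kappa> * t * norm r \<le> \<kappa> * t * t" using \<kappa>(1) by (intro mult_left_mono) (auto simp: t_def)
      ultimately show ?thesis using Cauchy_Schwarz_ineq2[of "y + y'" r] by (simp add: algebra_simps)
    qed
    ultimately have "\<bar>f x - f x'\<bar> \<le> \<kappa> * t\<^sup>2 + norm y * norm r" by (simp add: power2_eq_square algebra_simps)
    then show "\<bar>f x - f (fst p0)\<bar>
        \<le> \<kappa> * (norm (Q *v x + q + transpose A *v y) + norm r)\<^sup>2 + norm y * norm r"
      unfolding const t_def s_def .
  qed (use \<kappa> in auto)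
qed

text \<open>There are finitely many pairs of negative and positive index sets: each contributes one
  value to \<open>V\<close>, the constants are summed and the thresholds minimized.\<close>

lemma kkt_value_bound:
  obtains V \<kappa> \<eta> where "finite V" "\<kappa> \<ge> 0" "\<eta> > 0" "\<And>x y r. y \<in> subdiff_indicator C (A *v x + r) \<Longrightarrow>
      norm (Q *v x + q + transpose A *v y) + norm r \<le> \<eta> \<Longrightarrow>
      \<exists>c\<in>V. \<bar>f x - c\<bar> \<le> \<kappa> * (norm (Q *v x + q + transpose A *v y) + norm r)\<^sup>2 + norm y * norm r"
proof -
  have "\<forall>P. \<exists>\<kappa> \<eta> c. \<kappa> \<ge> 0 \<and> \<eta> > 0 \<and> (\<forall>x y r. y \<in> subdiff_indicator C (A *v x + r) \<longrightarrow>
      P = ({j. y $ j < 0}, {j. 0 < y $ j}) \<longrightarrow>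
      norm (Q *v x + q + transpose A *v y) + norm r \<le> \<eta> \<longrightarrow>
      \<bar>f x - c\<bar> \<le> \<kappa> * (norm (Q *v x + q + transpose A *v y) + norm r)\<^sup>2 + norm y * norm r)"
  proof
    fix P :: "'m set \<times> 'm set"
    obtain \<kappa> \<eta> c where "\<kappa> \<ge> 0" "\<eta> > 0" "\<And>x y r. y \<in> subdiff_indicator C (A *v x + r) \<Longrightarrow>
      fst P = {j. y $ j < 0} \<Longrightarrow> snd P = {j. 0 < y $ j} \<Longrightarrow>
      norm (Q *v x + q + transpose A *v y) + norm r \<le> \<eta> \<Longrightarrow>
      \<bar>f x - c\<bar> \<le> \<kappa> * (norm (Q *v x + q + transpose A *v y) + norm r)\<^sup>2 + norm y * norm r"
      using pattern_value_bound[of "fst P" "snd P"] by blast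
    then show "\<exists>\<kappa> \<eta> c. \<kappa> \<ge> 0 \<and> \<eta> > 0 \<and> (\<forall>x y r. y \<in> subdiff_indicator C (A *v x + r) \<longrightarrow>
      P = ({j. y $ j < 0}, {j. 0 < y $ j}) \<longrightarrow>
      norm (Q *v x + q + transpose A *v y) + norm r \<le> \<eta> \<longrightarrow>
      \<bar>f x - c\<bar> \<le> \<kappa> * (norm (Q *v x + q + transpose A *v y) + norm r)\<^sup>2 + norm y * norm r)"
      by (intro exI[of _ \<kappa>] exI[of _ \<eta>] exI[of _ c]) auto
  qed
  then obtain k e c where kec: "\<And>P. k P \<ge> 0" "\<And>P. e P > 0"
    "\<And>P x y r. y \<in> subdiff_indicator C (A *v x + r) \<Longrightarrow>
      P = ({j. y $ j < 0}, {j. 0 < y $ j}) \<Longrightarrow>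
      norm (Q *v x + q + transpose A *v y) + norm r \<le> e P \<Longrightarrow>
      \<bar>f x - c P\<bar> \<le> k P * (norm (Q *v x + q + transpose A *v y) + norm r)\<^sup>2 + norm y * norm r"
    by metis
  show ?thesis
  proof (rule that[of "range c" "sum k UNIV" "Min (range e)"])
    show "Min (range e) > 0" using kec(2) by (subst Min_gr_iff) auto
    show "sum k UNIV \<ge> 0" using kec(1) by (simp add: sum_nonneg)
    fix x y r assume y: "y \<in> subdiff_indicator C (A *v x + r)"
      and small: "norm (Q *v x + q + transpose A *v y) + norm r \<le> Min (range e)"
    define P where "P = ({j. y $ j < 0}, {j. 0 < y $ j})"
    have "Min (range e) \<le> e P" by (intro Min_le) auto
    then have "\<bar>f x - c P\<bar> \<le> k P * (norm (Q *v x + q + transpose A *v y) + norm r)\<^sup>2 + norm y * norm r"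
      using kec(3)[OF y P_def] order_trans[OF small] by blast
    also have "\<dots> \<le> sum k UNIV * (norm (Q *v x + q + transpose A *v y) + norm r)\<^sup>2 + norm y * norm r"
      using kec(1) by (intro add_right_mono mult_right_mono member_le_sum) auto
    finally show "\<exists>c\<in>range c. \<bar>f x - c\<bar> \<le> sum k UNIV * (norm (Q *v x + q + transpose A *v y) + norm r)\<^sup>2 + norm y * norm r"
      by blast
  qed simp
qed

section \<open>Descent and convergence of the inexact proximal point iteration\<close>

lemma proximal_step_descent:
  assumes QP: "pos_def (Q + P)" and p: "\<And>d. p * (norm d)\<^sup>2 \<le> d \<bullet> (P *v d)"
    and y: "y \<in> subdiff_indicator C (A *v x' + r')" and feas: "A *v x + r \<in> C"
  shows "p/2 * (norm (x' - x))\<^sup>2 \<le> f x - f x'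
    + norm (Q *v x' + q + transpose A *v y + P *v (x' - x)) * norm (x' - x) + norm y * (norm r + norm r')"
proof -
  define d where "d = x - x'"
  define e where "e = Q *v x' + q + transpose A *v y + P *v (x' - x)"
  have "P *v (x' - x) = - (P *v d)"
    by (simp add: d_def matrix_vector_mult_diff_distrib)
  then have "Q *v x' + q = e - transpose A *v y + P *v d" by (simp add: e_def)
  then have fd: "f x - f x' = e \<bullet> d - y \<bullet> (A *v d) + (P *v d) \<bullet> d + 1/2 * (d \<bullet> (Q *v d))"
    unfolding f_expand[of x x'] d_def[symmetric]
    by (simp only: inner_add_left inner_diff_left inner_transpose_mult)
  \<comment> \<open>Normality at the new shifted point is tested against the old one, which also
    lies in \<open>C\<close>; undoing the shifts leaves the pairing of \<open>y\<close> with
    \<open>r - r'\<close>.\<close>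
  have "y \<bullet> ((A *v x + r) - (A *v x' + r')) \<le> 0"
    using y feas unfolding subdiff_indicator_def by (auto split: if_splits)
  moreover have "A *v d = ((A *v x + r) - (A *v x' + r')) - (r - r')"
    by (simp add: d_def matrix_vector_mult_diff_distrib)
  moreover have "\<bar>y \<bullet> (r - r')\<bar> \<le> norm y * (norm r + norm r')"
    using Cauchy_Schwarz_ineq2[of y "r - r'"] norm_triangle_ineq4[of r r']
    by (meson mult_left_mono norm_ge_zero order_trans)
  ultimately have yA: "y \<bullet> (A *v d) \<le> norm y * (norm r + norm r')"
    by (smt (verit) inner_diff_right)
  have ed: "- (e \<bullet> d) \<le> norm e * norm d" using Cauchy_Schwarz_ineq2[of e d] by linarith
  \<comment> \<open>The form of \<open>P\<close> plus half that of \<open>Q\<close> is half the form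
    of \<open>P\<close> plus half that of \<open>Q + P\<close>. The latter is nonnegative, so the
    coefficient \<open>p/2\<close> remains.\<close>
  have "0 \<le> d \<bullet> ((Q + P) *v d)"
    using QP unfolding pos_def_def by (cases "d = 0") (auto simp: less_imp_le)
  then have "0 \<le> d \<bullet> (Q *v d) + d \<bullet> (P *v d)" by (simp add: matrix_vector_mult_add_rdistrib inner_add_right)
  moreover have "p * (norm d)\<^sup>2 \<le> d \<bullet> (P *v d)" by (rule p)
  ultimately have "p/2 * (norm d)\<^sup>2 \<le> (P *v d) \<bullet> d + 1/2 * (d \<bullet> (Q *v d))"
    unfolding inner_commute[of "P *v d"] by linarith
  then have "p/2 * (norm d)\<^sup>2 \<le> f x - f x' + norm e * norm d + norm y * (norm r + norm r')"
    using fd yA ed by linarith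
  then show ?thesis unfolding e_def d_def by (simp add: norm_minus_commute)
qed

lemma inexact_proximal_point_R_linear:
  fixes P :: "real^'n^'n" and w :: "nat \<Rightarrow> real^'n" and v r :: "nat \<Rightarrow> real^'m"
  assumes QP: "pos_def (Q + P)" and p: "0 < p" "\<And>d. p * (norm d)\<^sup>2 \<le> d \<bullet> (P *v d)"
    and \<rho>: "0 < \<rho>" "\<rho> < 1" and c: "0 \<le> c"
    and normal: "\<And>i. v i \<in> subdiff_indicator C (A *v w i + r i)"
    and step: "\<And>i. norm (Q *v w (Suc i) + q + transpose A *v v (Suc i) + P *v (w (Suc i) - w i)) \<le> c * \<rho> ^ i"
    and r: "\<And>i. norm (r i) \<le> c * \<rho> ^ i"
  obtains ws where "R_linear w" "w \<longlonglongrightarrow> ws" "A *v ws \<in> C"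
    "\<And>x. A *v x \<in> C \<Longrightarrow> 0 \<le> (Q *v ws + q) \<bullet> (x - ws)"
proof -
  obtain KQ where KQ: "KQ > 0" "\<And>x. norm (Q *v x) \<le> KQ * norm x" using matrix_norm_bound[of Q] by blast
  obtain KP where KP: "KP > 0" "\<And>x. norm (P *v x) \<le> KP * norm x" using matrix_norm_bound[of P] by blast
  obtain kb where kb: "kb \<ge> 0" "\<And>y z. y \<in> subdiff_indicator C z \<Longrightarrow>
    \<exists>y'\<in>subdiff_indicator C z. transpose A *v y' = transpose A *v y \<and> norm y' \<le> kb * norm (transpose A *v y)"
    using box_multiplier_bound[OF C_def] by blast
  obtain kh where kh: "kh \<ge> 0" "\<And>w r. A *v w + r \<in> C \<Longrightarrow> \<exists>p. A *v p \<in> C \<and> norm (w - p) \<le> kh * norm r"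
    using near_feasible_projection[OF C_def feasible] by blast
  obtain B0 where B0: "\<And>x. A *v x \<in> C \<Longrightarrow> B0 \<le> f x" using lower_bounded unfolding bdd_below_def by blast
  have "\<forall>i. \<exists>y'\<in>subdiff_indicator C (A *v w i + r i). transpose A *v y' = transpose A *v v i \<and> norm y' \<le> kb * norm (transpose A *v v i)"
    using kb(2)[OF normal] by blast
  then obtain y where y: "\<And>i. y i \<in> subdiff_indicator C (A *v w i + r i)"
    "\<And>i. transpose A *v y i = transpose A *v v i" "\<And>i. norm (y i) \<le> kb * norm (transpose A *v v i)"
    by metis
  define e where "e = (\<lambda>i. Q *v w (Suc i) + q + transpose A *v y (Suc i) + P *v (w (Suc i) - w i))"
  have e: "norm (e i) \<le> c * \<rho> ^ i" for i using step[of i] by (simp only: e_def y(2))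
  define d where "d = (\<lambda>i. norm (w (Suc i) - w i))"
  \<comment> \<open>\<open>N\<close> is a nondecreasing majorant of the iterates and, shifted by one
    index, of the step lengths. Starting at 1 or more lets it absorb constant terms too.\<close>
  define N0 where "N0 = 1 + norm (w 0)"
  define N where "N = (\<lambda>i. N0 + (\<Sum>j<i. d j))"
  have d0: "d i \<ge> 0" for i by (simp add: d_def)
  have N_Suc: "N (Suc i) = N i + d i" for i by (simp add: N_def)
  have N_mono: "N i \<le> N j" if "i \<le> j" for i j
    using that by (induction j rule: dec_induct) (auto simp: N_Suc intro: add_increasing2 d0)
  have N1: "1 \<le> N i" for i using N_mono[of 0 i] by (simp add: N_def N0_def)
  have wN: "norm (w i) \<le> N i" for i
  proof (induction i)
    case (Suc i)
    have "norm (w (Suc i)) \<le> norm (w i) + d i" unfolding d_def by (rule norm_triangle_sub)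
    then show ?case using Suc by (simp add: N_Suc)
  qed (simp add: N_def N0_def)
  have dN: "d i \<le> N (Suc i)" for i using N1[of i] by (simp add: N_Suc)
  have \<rho>1: "\<rho> ^ i \<le> 1" "0 < \<rho> ^ i" for i using \<rho> by (auto simp: power_le_one)
  \<comment> \<open>One summand for each term when the residual equation is solved for
    \<open>transpose A *v v (Suc i)\<close>: the error, \<open>Q *v w (Suc i)\<close>,
    \<open>q\<close> and the proximal term.\<close>
  define G where "G = c + KQ + norm q + KP"
  have G: "G \<ge> 0" using c KQ KP by (simp add: G_def)
  have yN: "norm (y (Suc i)) \<le> kb * (G * N (Suc i))" for i
  proof -
    have "transpose A *v v (Suc i) = e i - Q *v w (Suc i) - q - P *v (w (Suc i) - w i)"
      unfolding e_def y(2) by simp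
    then have "norm (transpose A *v v (Suc i)) \<le> norm (e i) + norm (Q *v w (Suc i)) + norm q + norm (P *v (w (Suc i) - w i))"
      by (smt (verit) norm_triangle_ineq4)
    also have "\<dots> \<le> c * N (Suc i) + KQ * N (Suc i) + norm q * N (Suc i) + KP * N (Suc i)"
    proof (intro add_mono)
      have "c * \<rho> ^ i \<le> c * N (Suc i)" using c \<rho>1[of i] N1[of "Suc i"] by (intro mult_left_mono) auto
      then show "norm (e i) \<le> c * N (Suc i)" using e[of i] by linarith
      show "norm (Q *v w (Suc i)) \<le> KQ * N (Suc i)"
        using KQ(2)[of "w (Suc i)"] mult_left_mono[OF wN[of "Suc i"], of KQ] KQ(1) by linarith
      show "norm q \<le> norm q * N (Suc i)" using mult_left_mono[OF N1[of "Suc i"], of "norm q"] by simp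
      show "norm (P *v (w (Suc i) - w i)) \<le> KP * N (Suc i)"
        using KP(2)[of "w (Suc i) - w i"] mult_left_mono[OF dN[of i], of KP] KP(1) unfolding d_def by linarith
    qed
    also have "\<dots> = G * N (Suc i)" by (simp add: G_def algebra_simps)
    finally have "kb * norm (transpose A *v v (Suc i)) \<le> kb * (G * N (Suc i))"
      using kb(1) by (intro mult_left_mono)
    then show ?thesis using y(3)[of "Suc i"] by linarith
  qed
  define a where "a = p / 2"
  have a: "a > 0" using p(1) by (simp add: a_def)
  define G1 where "G1 = c + kb * G * (2 * c)"
  have G1: "G1 \<ge> 0" using c kb G by (simp add: G1_def)
  have yz: "y i \<in> subdiff_indicator C (A *v w i + r i)" "A *v w i + r i \<in> C" for i
    using y(1)[of i] by (auto simp: subdiff_indicator_def split: if_splits)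
  have descent: "a * (d i)\<^sup>2 \<le> f (w i) - f (w (Suc i)) + G1 * (\<rho> ^ i * N (Suc i))" for i
  proof -
    have "a * (d i)\<^sup>2 \<le> f (w i) - f (w (Suc i)) + norm (e i) * d i
        + norm (y (Suc i)) * (norm (r i) + norm (r (Suc i)))"
      unfolding a_def d_def e_def by (rule proximal_step_descent[OF QP p(2) yz(1) yz(2)])
    moreover have "norm (e i) * d i \<le> (c * \<rho> ^ i) * N (Suc i)"
      using e[of i] dN[of i] c \<rho>1[of i] by (intro mult_mono) (auto simp: d0)
    moreover have "norm (y (Suc i)) * (norm (r i) + norm (r (Suc i))) \<le> (kb * (G * N (Suc i))) * (2 * c * \<rho> ^ i)"
    proof (intro mult_mono yN)
      have "c * \<rho> ^ Suc i \<le> c * \<rho> ^ i" using c \<rho> by (intro mult_left_mono power_decreasing) auto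
      then show "norm (r i) + norm (r (Suc i)) \<le> 2 * c * \<rho> ^ i" using r[of i] r[of "Suc i"] by simp
      show "0 \<le> kb * (G * N (Suc i))" using kb G N1[of "Suc i"] by simp
    qed auto
    ultimately show ?thesis by (simp add: G1_def algebra_simps)
  qed
  \<comment> \<open>Half the product of two bounds: the sum of the gradients at \<open>w i\<close>
    and at its nearby feasible point, relative to \<open>N i\<close>, and their distance, relative
    to \<open>\<rho> ^ i\<close>.\<close>
  define G2 where "G2 = 1/2 * ((2 * KQ + KQ * (kh * c) + 2 * norm q) * (kh * c))"
  have G2: "G2 \<ge> 0" using KQ kh c by (simp add: G2_def)
  have lower: "B0 \<le> f (w i) + G2 * (\<rho> ^ i * N i)" for i
  proof -
    obtain x where x: "A *v x \<in> C" "norm (w i - x) \<le> kh * norm (r i)" using kh(2)[OF yz(2)] by blast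
    have wx: "norm (w i - x) \<le> kh * c * \<rho> ^ i"
      using x(2) mult_left_mono[OF r[of i] kh(1)] by (simp add: mult.assoc)
    have "kh * c * \<rho> ^ i \<le> kh * c * 1" using kh c \<rho>1 by (intro mult_left_mono) auto
    then have "norm x \<le> N i + kh * c" using wx wN[of i] norm_triangle_ineq4[of "w i" "w i - x"] by simp
    then have "KQ * norm x \<le> KQ * (N i + kh * c)" using KQ(1) by (intro mult_left_mono) auto
    moreover have "KQ * norm (w i) \<le> KQ * N i" using KQ(1) wN[of i] by (intro mult_left_mono) auto
    moreover have "norm ((Q *v w i + q) + (Q *v x + q)) \<le> norm (Q *v w i) + norm q + (norm (Q *v x) + norm q)"
      by (intro norm_triangle_le add_mono norm_triangle_ineq)
    ultimately have "norm ((Q *v w i + q) + (Q *v x + q)) \<le> 2 * KQ * N i + KQ * (kh * c) + 2 * norm q"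
      using KQ(2)[of "w i"] KQ(2)[of x] by (simp add: algebra_simps)
    also have "\<dots> \<le> (2 * KQ + KQ * (kh * c) + 2 * norm q) * N i"
    proof -
      have "(KQ * (kh * c) + 2 * norm q) * 1 \<le> (KQ * (kh * c) + 2 * norm q) * N i"
        using KQ kh c N1 by (intro mult_left_mono) auto
      then show ?thesis by (simp add: algebra_simps)
    qed
    finally have g: "norm ((Q *v w i + q) + (Q *v x + q)) \<le> (2 * KQ + KQ * (kh * c) + 2 * norm q) * N i" .
    have "- (((Q *v w i + q) + (Q *v x + q)) \<bullet> (w i - x)) \<le> norm ((Q *v w i + q) + (Q *v x + q)) * norm (w i - x)"
      using Cauchy_Schwarz_ineq2[of "(Q *v w i + q) + (Q *v x + q)" "w i - x"] by linarith
    also have "\<dots> \<le> ((2 * KQ + KQ * (kh * c) + 2 * norm q) * N i) * (kh * c * \<rho> ^ i)"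
      using g wx order_trans[OF norm_ge_zero g] by (intro mult_mono) auto
    finally have "f x - f (w i) \<le> G2 * (\<rho> ^ i * N i)"
      using f_diff[of "w i" x] unfolding G2_def by (simp add: algebra_simps)
    then show ?thesis using B0[OF x(1)] by linarith
  qed
  define K where "K = \<bar>f (w 0) - B0\<bar> + G2 + G1 / (1 - \<rho>)"
  have K: "K \<ge> 0" using G2 G1 \<rho> by (simp add: K_def)
  have sq: "a * (\<Sum>j<i. (d j)\<^sup>2) \<le> K * N i" for i
  proof -
    \<comment> \<open>The factor \<open>(1 - \<rho> ^ i) / (1 - \<rho>)\<close> is the partial
      geometric sum; monotonicity of \<open>N\<close> allows its latest value to be used in all
      summands.\<close>
    have tele: "a * (\<Sum>j<i. (d j)\<^sup>2) \<le> f (w 0) - f (w i) + G1 / (1 - \<rho>) * ((1 - \<rho> ^ i) * N i)"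
    proof (induction i)
      case (Suc i)
      have "G1 / (1 - \<rho>) * ((1 - \<rho> ^ i) * N i) \<le> G1 / (1 - \<rho>) * ((1 - \<rho> ^ i) * N (Suc i))"
        using G1 \<rho> \<rho>1 N_mono[of i "Suc i"] by (intro mult_left_mono) auto
      moreover have "G1 / (1 - \<rho>) * ((1 - \<rho> ^ i) * N (Suc i)) + G1 * (\<rho> ^ i * N (Suc i))
         = G1 / (1 - \<rho>) * ((1 - \<rho> ^ Suc i) * N (Suc i))"
      proof -
        define g where "g = G1 / (1 - \<rho>)"
        have "G1 = g * (1 - \<rho>)" using \<rho> by (simp add: g_def)
        moreover have "g * ((1 - \<rho> ^ i) * N (Suc i)) + g * (1 - \<rho>) * (\<rho> ^ i * N (Suc i)) = g * ((1 - \<rho> ^ Suc i) * N (Suc i))"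
          by (simp add: algebra_simps)
        ultimately show ?thesis unfolding g_def[symmetric] by metis
      qed
      ultimately show ?case using Suc descent[of i] by (simp add: distrib_left)
    qed simp
    have "G1 / (1 - \<rho>) * ((1 - \<rho> ^ i) * N i) \<le> G1 / (1 - \<rho>) * N i"
      using G1 \<rho> \<rho>1[of i] N1[of i] by (intro mult_left_mono) (auto intro: mult_left_le_one_le)
    moreover have "G2 * (\<rho> ^ i * N i) \<le> G2 * N i"
      using G2 \<rho>1[of i] N1[of i] by (intro mult_left_mono) (auto intro: mult_left_le_one_le)
    moreover have "\<bar>f (w 0) - B0\<bar> * 1 \<le> \<bar>f (w 0) - B0\<bar> * N i" using N1 by (intro mult_left_mono) auto
    ultimately show ?thesis using tele lower[of i] by (simp add: K_def distrib_right)
  qed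
  define X where "X = 2 * N0\<^sup>2"
  define Y where "Y = 2 * (K / a)"
  define G3 where "G3 = X + Y"
  have XY: "X \<ge> 0" "Y \<ge> 0" using K a by (simp_all add: X_def Y_def)
  then have G3: "G3 \<ge> 0" by (simp add: G3_def)
  have growth: "N (Suc i) \<le> 2 * G3 * (1 + real i)" for i
  proof -
    have "N (Suc i) \<le> X + Y * real (Suc i)"
      unfolding N_def X_def Y_def
    proof (rule linear_growth_from_square_sums[OF a K])
      show "1 \<le> N0" by (simp add: N0_def)
      show "a * (\<Sum>j<Suc i. (d j)\<^sup>2) \<le> K * (N0 + (\<Sum>j<Suc i. d j))" using sq[of "Suc i"] unfolding N_def .
    qed (simp add: d0)
    moreover have "0 \<le> X * real i" "0 \<le> Y * real i" using XY by simp_all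
    moreover have "2 * G3 * (1 + real i) = 2 * X + 2 * Y + 2 * (X * real i) + 2 * (Y * real i)"
      "Y * real (Suc i) = Y + Y * real i" by (simp_all add: G3_def algebra_simps)
    ultimately show ?thesis using XY by linarith
  qed
  \<comment> \<open>From here on the slower rate \<open>\<sigma>\<close> replaces
    \<open>\<rho>\<close>, which pays for the linear growth of \<open>N\<close>.\<close>
  obtain \<sigma> K5 where \<sigma>: "0 < \<sigma>" "\<sigma> < 1" "\<rho> < \<sigma>" "K5 > 0" "\<And>i. (1 + real i) * \<rho> ^ i \<le> K5 * \<sigma> ^ i"
    using linear_times_geometric[OF \<rho>] by blast
  define G4 where "G4 = 2 * G3 * K5"
  have G4: "G4 \<ge> 0" using G3 \<sigma> by (simp add: G4_def)
  have \<rho>N: "\<rho> ^ i * N (Suc i) \<le> G4 * \<sigma> ^ i" for i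
  proof -
    have "\<rho> ^ i * N (Suc i) \<le> \<rho> ^ i * (2 * G3 * (1 + real i))" using growth \<rho>1[of i] by (intro mult_left_mono) auto
    also have "\<dots> = 2 * G3 * ((1 + real i) * \<rho> ^ i)" by simp
    also have "\<dots> \<le> 2 * G3 * (K5 * \<sigma> ^ i)" using \<sigma>(5)[of i] G3 by (intro mult_left_mono) auto
    finally show ?thesis by (simp add: G4_def)
  qed
  have \<rho>\<sigma>: "\<rho> ^ i \<le> \<sigma> ^ i" for i using \<rho> \<sigma> by (intro power_mono) auto
  have \<sigma>1: "\<sigma> ^ i \<le> 1" "0 < \<sigma> ^ i" for i using \<sigma> by (auto simp: power_le_one)
  have yr: "norm (y (Suc i)) * norm (r (Suc i)) \<le> kb * G * c * G4 * \<sigma> ^ i" for i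
  proof -
    have "c * \<rho> ^ Suc i \<le> c * \<rho> ^ i" using c \<rho> by (intro mult_left_mono power_decreasing) auto
    then have "norm (r (Suc i)) \<le> c * \<rho> ^ i" using r[of "Suc i"] by linarith
    then have "norm (y (Suc i)) * norm (r (Suc i)) \<le> (kb * (G * N (Suc i))) * (c * \<rho> ^ i)"
      using kb G N1[of "Suc i"] by (intro mult_mono yN) auto
    also have "\<dots> = kb * G * c * (\<rho> ^ i * N (Suc i))" by simp
    also have "\<dots> \<le> kb * G * c * (G4 * \<sigma> ^ i)" using kb G c by (intro mult_left_mono \<rho>N) auto
    finally show ?thesis by simp
  qed
  define s where "s = (\<lambda>i. Q *v w (Suc i) + q + transpose A *v y (Suc i))"
  have s: "norm (s i) \<le> c * \<rho> ^ i + KP * d i" for i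
  proof -
    have "s i = e i - P *v (w (Suc i) - w i)" by (simp add: s_def e_def)
    then show ?thesis using norm_triangle_ineq4[of "e i" "P *v (w (Suc i) - w i)"] e[of i] KP(2)[of "w (Suc i) - w i"]
      unfolding d_def by simp
  qed
  obtain V \<kappa> \<eta> where V: "finite V" "\<kappa> \<ge> 0" "\<eta> > 0" "\<And>x y r. y \<in> subdiff_indicator C (A *v x + r) \<Longrightarrow>
      norm (Q *v x + q + transpose A *v y) + norm r \<le> \<eta> \<Longrightarrow>
      \<exists>c\<in>V. \<bar>f x - c\<bar> \<le> \<kappa> * (norm (Q *v x + q + transpose A *v y) + norm r)\<^sup>2 + norm y * norm r"
    using kkt_value_bound by metis
  \<comment> \<open>A single constant for every use: \<open>2 * c\<close> and \<open>KP\<close> for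
    the residual, \<open>G1 * G4\<close> for descent, the remaining terms for the value bound. The 8
    arises from doubling the square of \<open>2 * c\<close>.\<close>
  define M where "M = 2 * c + KP + 8 * \<kappa> * c\<^sup>2 + 2 * \<kappa> * KP\<^sup>2 + kb * G * c * G4 + G1 * G4"
  have M_parts: "0 \<le> 8 * \<kappa> * c\<^sup>2" "0 \<le> 2 * \<kappa> * KP\<^sup>2" "0 \<le> kb * G * c * G4" "0 \<le> G1 * G4"
    using V(2) kb G c G4 G1 by simp_all
  have M: "M \<ge> 0" "2 * c \<le> M" "KP \<le> M" "G1 * G4 \<le> M" "8 * \<kappa> * c\<^sup>2 + kb * G * c * G4 \<le> M" "2 * \<kappa> * KP\<^sup>2 \<le> M"
    using M_parts c KP(1) unfolding M_def by linarith+
  have res: "norm (s i) + norm (r (Suc i)) \<le> 2 * c * \<sigma> ^ i + KP * d i" for i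
  proof -
    have "c * \<rho> ^ Suc i \<le> c * \<rho> ^ i" using c \<rho> by (intro mult_left_mono power_decreasing) auto
    moreover have "c * \<rho> ^ i \<le> c * \<sigma> ^ i" using c \<rho>\<sigma> by (intro mult_left_mono) auto
    ultimately show ?thesis using s[of i] r[of "Suc i"] by linarith
  qed
  have D1: "a * (d i)\<^sup>2 \<le> f (w i) - f (w (Suc i)) + M * \<sigma> ^ i" for i
    proof -
      have "G1 * (\<rho> ^ i * N (Suc i)) \<le> G1 * (G4 * \<sigma> ^ i)" using G1 by (intro mult_left_mono \<rho>N)
      also have "\<dots> \<le> M * \<sigma> ^ i" using M(4) \<sigma>1[of i] by (simp flip: mult.assoc)
      finally show ?thesis using descent[of i] by linarith
    qed
  have D2: "B0 - G2 * G4 \<le> f (w i)" for i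
    proof -
      have "\<rho> ^ i * N i \<le> \<rho> ^ i * N (Suc i)" using N_mono[of i "Suc i"] \<rho>1[of i] by (intro mult_left_mono) auto
      also have "\<dots> \<le> G4 * \<sigma> ^ i" by (rule \<rho>N)
      also have "\<dots> \<le> G4" using G4 \<sigma>1[of i] by (intro mult_left_le) auto
      finally have "G2 * (\<rho> ^ i * N i) \<le> G2 * G4" using G2 by (intro mult_left_mono)
      then show ?thesis using lower[of i] by linarith
    qed
  have D3: "\<exists>c\<in>V. \<bar>f (w (Suc i)) - c\<bar> \<le> M * ((d i)\<^sup>2 + \<sigma> ^ i)" if small: "M * (d i + \<sigma> ^ i) \<le> \<eta>" for i
    proof -
      define t where "t = norm (s i) + norm (r (Suc i))"
      have "2 * c * \<sigma> ^ i + KP * d i \<le> M * \<sigma> ^ i + M * d i"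
        using M \<sigma>1[of i] d0[of i] by (intro add_mono mult_right_mono) auto
      then have "t \<le> \<eta>" using res[of i] small unfolding t_def by (simp add: algebra_simps)
      then obtain v0 where v0: "v0 \<in> V" "\<bar>f (w (Suc i)) - v0\<bar> \<le> \<kappa> * t\<^sup>2 + norm (y (Suc i)) * norm (r (Suc i))"
        using V(4)[OF y(1)[of "Suc i"]] unfolding t_def s_def by blast
      have "t\<^sup>2 \<le> (2 * c * \<sigma> ^ i + KP * d i)\<^sup>2" using res[of i] unfolding t_def by (intro power_mono) auto
      moreover have "(2 * c * \<sigma> ^ i + KP * d i)\<^sup>2 \<le> 2 * (2 * c * \<sigma> ^ i)\<^sup>2 + 2 * (KP * d i)\<^sup>2"
        using sum_squares_bound[of "2 * c * \<sigma> ^ i" "KP * d i"] by (simp add: power2_sum)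
      moreover have "(2 * c * \<sigma> ^ i)\<^sup>2 \<le> 4 * c\<^sup>2 * \<sigma> ^ i"
      proof -
        \<comment> \<open>One power of \<open>\<sigma> ^ i\<close> is given away, since the pairing
          of multiplier and infeasibility is bounded only at the rate \<open>\<sigma> ^ i\<close> as
          well.\<close>
        have "\<sigma> ^ i * \<sigma> ^ i \<le> \<sigma> ^ i" using \<sigma>1[of i] by (intro mult_left_le) auto
        then have "4 * c\<^sup>2 * (\<sigma> ^ i * \<sigma> ^ i) \<le> 4 * c\<^sup>2 * \<sigma> ^ i" by (intro mult_left_mono) auto
        then show ?thesis by (simp add: power2_eq_square algebra_simps)
      qed
      ultimately have "t\<^sup>2 \<le> 2 * (4 * c\<^sup>2 * \<sigma> ^ i) + 2 * (KP * d i)\<^sup>2" by linarith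
      then have "t\<^sup>2 \<le> 8 * c\<^sup>2 * \<sigma> ^ i + 2 * KP\<^sup>2 * (d i)\<^sup>2" by (simp add: power_mult_distrib)
      from mult_left_mono[OF this V(2)]
      have "\<bar>f (w (Suc i)) - v0\<bar> \<le> (2 * \<kappa> * KP\<^sup>2) * (d i)\<^sup>2 + (8 * \<kappa> * c\<^sup>2 + kb * G * c * G4) * \<sigma> ^ i"
        using v0(2) yr[of i] by (simp add: algebra_simps)
      also have "\<dots> \<le> M * (d i)\<^sup>2 + M * \<sigma> ^ i"
        using M \<sigma>1[of i] by (intro add_mono mult_right_mono) auto
      finally show ?thesis using v0(1) by (auto simp: algebra_simps)
    qed
  obtain K' \<tau> where K': "0 < \<tau>" "\<tau> < 1" "\<And>i. d i \<le> K' * \<tau> ^ i"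
    using descent_finite_values_geometric[where F = "\<lambda>i. f (w i)", OF a M(1) \<sigma>(1,2) d0 D1 D2 V(1,3) D3] by blast
  have Rlin: "R_linear w" using K' by (intro geometric_steps_R_linear[of \<tau> w K']) (auto simp: d_def)
  then obtain ws where ws: "w \<longlonglongrightarrow> ws" unfolding R_linear_def by blast
  have pow0: "(\<lambda>i. \<rho> ^ i) \<longlonglongrightarrow> 0" "(\<lambda>i. \<sigma> ^ i) \<longlonglongrightarrow> 0" "(\<lambda>i. \<tau> ^ i) \<longlonglongrightarrow> 0"
    using \<rho> \<sigma> K' by (intro LIMSEQ_power_zero; simp)+
  have "(\<lambda>i. c * \<rho> ^ i) \<longlonglongrightarrow> c * 0" by (intro tendsto_intros pow0)
  then have "r \<longlonglongrightarrow> 0" by (intro Lim_null_comparison[OF always_eventually[of "\<lambda>i. norm (r i) \<le> c * \<rho> ^ i"]]) (auto simp: r)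
  then have zlim: "(\<lambda>i. A *v w i + r i) \<longlonglongrightarrow> A *v ws + 0"
    by (intro tendsto_add bounded_linear.tendsto[OF matrix_vector_mul_bounded_linear] ws)
  have "closed C"
  proof -
    have "C = cbox l u" unfolding C_def by (auto simp: mem_box_cart)
    then show ?thesis by (simp only: closed_cbox)
  qed
  then have "A *v ws + 0 \<in> C" using yz(2) zlim by (rule closed_sequentially)
  then have feas: "A *v ws \<in> C" by simp
  have dlim: "d \<longlonglongrightarrow> 0"
  proof (rule Lim_null_comparison)
    show "\<forall>\<^sub>F i in sequentially. norm (d i) \<le> K' * \<tau> ^ i" using K'(3) d0 by (intro always_eventually) auto
    have "(\<lambda>i. K' * \<tau> ^ i) \<longlonglongrightarrow> K' * 0" by (intro tendsto_intros pow0)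
    then show "(\<lambda>i. K' * \<tau> ^ i) \<longlonglongrightarrow> 0" by simp
  qed
  have vi: "0 \<le> (Q *v ws + q) \<bullet> (x - ws)" if x: "A *v x \<in> C" for x
  proof -
    \<comment> \<open>The multiplier is eliminated before passing to the limit, so the variational
      inequality follows without a limit of the multipliers.\<close>
    have low: "- ((c * \<rho> ^ i + KP * d i) * norm (x - w (Suc i))) - kb * G * c * G4 * \<sigma> ^ i
        \<le> (Q *v w (Suc i) + q) \<bullet> (x - w (Suc i))" for i
    proof -
      have "y (Suc i) \<bullet> (A *v x - (A *v w (Suc i) + r (Suc i))) \<le> 0"
        using y(1)[of "Suc i"] x unfolding subdiff_indicator_def by (auto split: if_splits)
      then have "y (Suc i) \<bullet> (A *v (x - w (Suc i))) \<le> y (Suc i) \<bullet> r (Suc i)"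
        by (simp add: matrix_vector_mult_diff_distrib inner_diff_right inner_add_right)
      also have "\<dots> \<le> kb * G * c * G4 * \<sigma> ^ i" using norm_cauchy_schwarz[of "y (Suc i)" "r (Suc i)"] yr[of i] by linarith
      finally have "y (Suc i) \<bullet> (A *v (x - w (Suc i))) \<le> kb * G * c * G4 * \<sigma> ^ i" .
      moreover have "- (s i \<bullet> (x - w (Suc i))) \<le> (c * \<rho> ^ i + KP * d i) * norm (x - w (Suc i))"
        using Cauchy_Schwarz_ineq2[of "s i" "x - w (Suc i)"] mult_right_mono[OF s[of i] norm_ge_zero[of "x - w (Suc i)"]]
        by linarith
      moreover have "(Q *v w (Suc i) + q) \<bullet> (x - w (Suc i)) = s i \<bullet> (x - w (Suc i)) - y (Suc i) \<bullet> (A *v (x - w (Suc i)))"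
        unfolding s_def by (simp only: inner_add_left inner_transpose_mult)
      ultimately show ?thesis by linarith
    qed
    have wS: "(\<lambda>i. w (Suc i)) \<longlonglongrightarrow> ws" using ws by (rule LIMSEQ_Suc)
    have lim: "(\<lambda>i. (Q *v w (Suc i) + q) \<bullet> (x - w (Suc i))) \<longlonglongrightarrow> (Q *v ws + q) \<bullet> (x - ws)"
      by (intro tendsto_intros bounded_linear.tendsto[OF matrix_vector_mul_bounded_linear] wS)
    have "(\<lambda>i. - ((c * \<rho> ^ i + KP * d i) * norm (x - w (Suc i))) - kb * G * c * G4 * \<sigma> ^ i)
        \<longlonglongrightarrow> - ((c * 0 + KP * 0) * norm (x - ws)) - kb * G * c * G4 * 0"
      by (intro tendsto_intros pow0 dlim wS)
    from this lim have "- ((c * 0 + KP * 0) * norm (x - ws)) - kb * G * c * G4 * 0 \<le> (Q *v ws + q) \<bullet> (x - ws)"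
      by (rule LIMSEQ_le) (use low in blast)
    then show ?thesis by simp
  qed
  show ?thesis using that[OF Rlin ws feas vi] .
qed

end

section \<open>Runs of P-ALM\<close>

lemma pos_def_invertible:
  assumes "pos_def M"
  shows "invertible M"
proof -
  have "M *v x = 0 \<longrightarrow> x = 0" for x using assms unfolding pos_def_def by (metis inner_zero_right less_irrefl)
  then show ?thesis by (metis invertible_left_inverse matrix_left_invertible_ker)
qed

lemma matrix_inv_mult_vector:
  fixes M :: "real^'n^'n"
  assumes "invertible M"
  shows "M *v (matrix_inv M *v x) = x"
proof -
  have "M ** matrix_inv M = mat 1"
    using someI_ex[OF assms[unfolded invertible_def]] unfolding matrix_inv_def by blast
  then show ?thesis by (simp add: matrix_vector_mul_assoc)
qed

lemma pos_def_inverse_lower_bound: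
  fixes M :: "real^'n^'n"
  assumes M: "pos_def M"
  obtains p where "p > 0" "\<And>x. p * (norm x)\<^sup>2 \<le> x \<bullet> (matrix_inv M *v x)"
proof -
  obtain c where c: "c > 0" "\<And>x. c * (norm x)\<^sup>2 \<le> x \<bullet> (M *v x)" using pos_def_lower_bound[OF M] by blast
  obtain K where K: "K > 0" "\<And>x. norm (M *v x) \<le> K * norm x" using matrix_norm_bound[of M] by blast
  show ?thesis
  \<comment> \<open>Writing \<open>x\<close> as \<open>M *v v\<close> turns the inverse form into
    that of \<open>M\<close> at \<open>v\<close>: \<open>c\<close> bounds it from below, and
    \<open>K\<close> converts \<open>norm v\<close> back to \<open>norm x\<close>.\<close>
  proof (rule that[of "c / K\<^sup>2"])
    fix x
    define v where "v = matrix_inv M *v x"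
    have x: "x = M *v v" unfolding v_def by (simp add: matrix_inv_mult_vector pos_def_invertible[OF M])
    have "(norm x)\<^sup>2 \<le> (K * norm v)\<^sup>2" unfolding x by (intro power_mono K) auto
    then have "c / K\<^sup>2 * (norm x)\<^sup>2 \<le> c / K\<^sup>2 * (K * norm v)\<^sup>2" using c K by (intro mult_left_mono) auto
    also have "\<dots> = c * (norm v)\<^sup>2" using K by (simp add: power_mult_distrib)
    also have "\<dots> \<le> v \<bullet> (M *v v)" by (rule c(2))
    also have "\<dots> = x \<bullet> v" using x by (simp add: inner_commute)
    finally show "c / K\<^sup>2 * (norm x)\<^sup>2 \<le> x \<bullet> (matrix_inv M *v x)" by (simp add: v_def)
  qed (use c K in auto)
qed

lemma axis_quadratic_form: "axis j 1 \<bullet> (M *v axis j 1) = (M :: real^'n^'n) $ j $ j"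
  by (simp add: inner_axis' matrix_vector_mult_basis column_def)

text \<open>For diagonal penalties the diagonal entries carry all the information; testing the order
  with unit vectors extracts it.\<close>

lemma loewner_ge_diag: "M \<succeq> N \<Longrightarrow> N $ j $ j \<le> M $ j $ j"
  using axis_quadratic_form[of j "M - N"] unfolding loewner_ge_def pos_semidef_def
  by (metis diff_ge_0_iff_ge vector_minus_component)

lemma diagonal_mult_component:
  assumes "diagonal S"
  shows "(S *v v) $ j = S $ j $ j * v $ j"
proof -
  have "(S *v v) $ j = (\<Sum>i\<in>UNIV. S $ j $ i * v $ i)" by (simp add: matrix_vector_mult_def)
  also have "\<dots> = (\<Sum>i\<in>UNIV. if i = j then S $ j $ j * v $ j else 0)"
    by (rule sum.cong) (use assms in \<open>auto simp: diagonal_def\<close>)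
  also have "\<dots> = S $ j $ j * v $ j" by simp
  finally show ?thesis .
qed

lemma diagonal_invertible:
  fixes S :: "real^'m^'m"
  assumes "diagonal S" "\<And>j. 0 < S $ j $ j"
  shows "invertible S"
proof -
  have "S *v x = 0 \<longrightarrow> x = 0" for x
    using diagonal_mult_component[OF assms(1), of x] assms(2)
    by (metis less_irrefl mult_eq_0_iff vec_eq_iff zero_index)
  then show ?thesis by (metis invertible_left_inverse matrix_left_invertible_ker)
qed

lemma enumerate_card_below:
  fixes S :: "nat set"
  assumes "infinite S"
  shows "card {j\<in>S. j < enumerate S n} = n"
proof -
  have "{j\<in>S. j < enumerate S n} = enumerate S ` {..<n}"
  proof
    show "{j\<in>S. j < enumerate S n} \<subseteq> enumerate S ` {..<n}"
    proof
      fix j assume j: "j \<in> {j\<in>S. j < enumerate S n}"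
      then obtain i where "enumerate S i = j" using enumerate_Ex assms by blast
      then show "j \<in> enumerate S ` {..<n}" using j assms by auto
    qed
  qed (use assms in \<open>auto simp: enumerate_in_set\<close>)
  moreover have "inj_on (enumerate S) {..<n}" using inj_enumerate[OF assms] inj_on_subset by blast
  ultimately show ?thesis by (simp add: card_image)
qed

locale palm_box_qp = box_qp Q q A l u C f + palm_run Q q A C Sx Symin Sy \<rho> \<delta> \<epsilon> x z y xh
  for Q :: "real^'n^'n" and q :: "real^'n" and A :: "real^'n^'m" and l u :: "real^'m"
    and C :: "(real^'m) set" and f :: "real^'n \<Rightarrow> real"
    and Sx :: "real^'n^'n" and Symin :: "real^'m^'m" and Sy :: "nat \<Rightarrow> real^'m^'m"
    and \<rho> :: real and \<delta> :: "nat \<Rightarrow> real" and \<epsilon> :: "nat \<Rightarrow> real"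
    and x :: "nat \<Rightarrow> real^'n" and z :: "nat \<Rightarrow> real^'m" and y :: "nat \<Rightarrow> real^'m"
    and xh :: "nat \<Rightarrow> real^'n"
begin

section \<open>Penalties, multipliers and residuals of a single iteration\<close>

abbreviation test :: "nat \<Rightarrow> bool" where "test k \<equiv> palm_test A Sy \<epsilon> x z k"

lemma convex_closed_C: "convex C" "closed C" "C \<noteq> {}"
proof -
  have "C = cbox l u" unfolding C_def by (auto simp: mem_box_cart)
  then show "convex C" "closed C" by auto
  show "C \<noteq> {}" using feasible by blast
qed

lemma Sy_diag_lower: "Symin $ j $ j \<le> Sy k $ j $ j"
proof (induction k)
  case 0
  show ?case using Sy0 by (rule loewner_ge_diag)
next
  case (Suc k)
  then show ?case using test_pass[of k] test_fail[of k] loewner_ge_diag order_trans by (cases "test k") blast+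
qed

lemma Symin_diag_pos: "0 < Symin $ j $ j"
  using Symin unfolding pos_def_def by (metis axis_eq_0_iff axis_quadratic_form zero_neq_one)

lemma Sy_diag_pos: "0 < Sy k $ j $ j"
  using Sy_diag_lower Symin_diag_pos by (rule order_less_le_trans[rotated])

lemma Sy_quadratic_form: "v \<bullet> (Sy k *v v) = (\<Sum>j\<in>UNIV. Sy k $ j $ j * (v $ j)\<^sup>2)"
  unfolding inner_vec_def diagonal_mult_component[OF Sy_diagonal]
  by (simp add: power2_eq_square mult_ac)

text \<open>The diagonals never drop below that of \<open>Symin\<close>, so one constant serves all
  \<open>k\<close>. Thus a test in varying weighted norms controls Euclidean infeasibility.\<close>

lemma norm_le_wnorm:
  obtains c where "c > 0" "\<And>k v. norm v \<le> c * wnorm (Sy k) v"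
proof -
  define s where "s = Min (range (\<lambda>j. Symin $ j $ j))"
  have s: "s > 0" unfolding s_def using Symin_diag_pos by (subst Min_gr_iff) auto
  have sle: "s \<le> Sy k $ j $ j" for k j
  proof -
    have "s \<le> Symin $ j $ j" unfolding s_def by (intro Min_le) auto
    then show ?thesis using Sy_diag_lower order_trans by blast
  qed
  show ?thesis
  proof (rule that[of "1 / sqrt s"])
    fix k and v :: "real^'m"
    have "s * (norm v)\<^sup>2 = (\<Sum>j\<in>UNIV. s * (v $ j)\<^sup>2)"
      by (simp add: norm_vec_def L2_set_def sum_nonneg sum_distrib_left)
    also have "\<dots> \<le> v \<bullet> (Sy k *v v)" unfolding Sy_quadratic_form
      by (intro sum_mono mult_right_mono sle) auto
    finally have "sqrt (s * (norm v)\<^sup>2) \<le> wnorm (Sy k) v" unfolding wnorm_def by (rule real_sqrt_le_mono)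
    then have "sqrt s * norm v \<le> wnorm (Sy k) v" by (simp add: real_sqrt_mult)
    then show "norm v \<le> 1 / sqrt s * wnorm (Sy k) v" using s by (simp add: pos_le_divide_eq mult.commute)
  qed (use s in simp)
qed

text \<open>The projection residual is normal to \<open>C\<close>, and the new multiplier is its
  image under a positive diagonal matrix. Rescaling the components keeps their signs, hence
  normality to a box.\<close>

lemma multiplier_normal: "y (Suc k) \<in> subdiff_indicator C (z (Suc k))"
proof -
  define a where "a = A *v x (Suc k) + matrix_inv (Sy k) *v y k"
  have z: "z (Suc k) = closest_point C a" using z_step by (simp add: a_def)
  have "z (Suc k) \<in> C" unfolding z using convex_closed_C by (intro closest_point_in_set)
  moreover have "(a - z (Suc k)) \<bullet> (z' - z (Suc k)) \<le> 0" if "z' \<in> C" for z'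
    unfolding z using convex_closed_C that by (intro closest_point_dot)
  ultimately have n: "a - z (Suc k) \<in> subdiff_indicator C (z (Suc k))"
    unfolding subdiff_indicator_def by auto
  have "invertible (Sy k)" using Sy_diagonal Sy_diag_pos by (rule diagonal_invertible)
  then have "y (Suc k) = Sy k *v (a - z (Suc k))" unfolding y_step a_def
    by (simp add: matrix_vector_right_distrib matrix_vector_mult_diff_distrib matrix_inv_mult_vector)
  then have "y (Suc k) $ j = Sy k $ j $ j * (a - z (Suc k)) $ j" for j
    by (simp only: diagonal_mult_component[OF Sy_diagonal])
  then have "y (Suc k) $ j < 0 \<longleftrightarrow> (a - z (Suc k)) $ j < 0" "0 < y (Suc k) $ j \<longleftrightarrow> 0 < (a - z (Suc k)) $ j" for j
    using Sy_diag_pos[of k j] by (simp_all only: mult_less_0_iff zero_less_mult_iff) auto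
  then show ?thesis using n unfolding subdiff_box_iff[OF C_def] by blast
qed

lemma stationarity_residual:
  "norm (Q *v x (Suc k) + q + transpose A *v y (Suc k) + matrix_inv Sx *v (x (Suc k) - xh k)) \<le> \<delta> k"
  using x_step[of k] unfolding y_step .

lemma dual_residual_bound:
  "norm (gradient f (x (Suc k)) + transpose A *v y (Suc k)) \<le> \<delta> k + norm (matrix_inv Sx *v (x (Suc k) - xh k))"
  unfolding gradient_f using stationarity_residual[of k]
    norm_triangle_ineq4[of "Q *v x (Suc k) + q + transpose A *v y (Suc k) + matrix_inv Sx *v (x (Suc k) - xh k)"
      "matrix_inv Sx *v (x (Suc k) - xh k)"]
  by (simp only: add_diff_cancel_right')

lemma delta_geometric: "\<delta> k \<le> \<rho> ^ k * \<delta> 0"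
proof (induction k)
  case (Suc k)
  have "\<delta> (Suc k) \<le> \<rho> * \<delta> k" by (rule delta_step)
  also have "\<dots> \<le> \<rho> * (\<rho> ^ k * \<delta> 0)" using Suc rho by (intro mult_left_mono) auto
  finally show ?case by simp
qed simp

lemma delta_tendsto: "\<delta> \<longlonglongrightarrow> 0"
proof (rule Lim_null_comparison)
  show "\<forall>\<^sub>F k in sequentially. norm (\<delta> k) \<le> \<rho> ^ k * \<delta> 0"
    using delta_geometric delta_pos by (intro always_eventually) (simp add: less_imp_le)
  have "(\<lambda>k. \<rho> ^ k * \<delta> 0) \<longlonglongrightarrow> 0 * \<delta> 0" using rho by (intro tendsto_intros LIMSEQ_power_zero) auto
  then show "(\<lambda>k. \<rho> ^ k * \<delta> 0) \<longlonglongrightarrow> 0" by simp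
qed

text \<open>While the center is frozen, the dual iterates are inexact proximal point steps for a solvable
  dual problem, hence Fejer monotone in the metric of the inverse penalties up to the errors.\<close>

lemma dual_fejer:
  assumes \<mu>: "\<mu> > 0" "\<And>d. \<mu> * (norm d)\<^sup>2 \<le> d \<bullet> ((Q + matrix_inv Sx) *v d)"
    and kkt: "(Q + matrix_inv Sx) *v p + (q - matrix_inv Sx *v xh k) + transpose A *v yb = 0"
    and yb: "yb \<in> subdiff_indicator C (A *v p)"
    and fail: "\<not> test k"
  shows "(\<Sum>j\<in>UNIV. (y (Suc k) $ j - yb $ j)\<^sup>2 / Sy (Suc k) $ j $ j)
    \<le> (\<Sum>j\<in>UNIV. (y k $ j - yb $ j)\<^sup>2 / Sy k $ j $ j) + (\<delta> k)\<^sup>2 / (2 * \<mu>)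
      - (wnorm (Sy k) (A *v x (Suc k) - z (Suc k)))\<^sup>2"
proof -
  define g where "g = A *v x (Suc k) - z (Suc k)"
  define dx where "dx = x (Suc k) - p"
  define dy where "dy = y (Suc k) - yb"
  define H where "H = Q + matrix_inv Sx"
  define e where "e = Q *v x (Suc k) + q + transpose A *v y (Suc k) + matrix_inv Sx *v (x (Suc k) - xh k)"
  have e_le: "norm e \<le> \<delta> k" unfolding e_def by (rule stationarity_residual)
  have e_eq: "e = H *v dx + transpose A *v dy"
  proof -
    have "e = e - ((Q + matrix_inv Sx) *v p + (q - matrix_inv Sx *v xh k) + transpose A *v yb)" using kkt by simp
    also have "\<dots> = H *v dx + transpose A *v dy"
      unfolding e_def H_def dx_def dy_def matrix_vector_mult_diff_distrib matrix_vector_mult_add_rdistrib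
      by (simp del: transpose_matrix_vector)
    finally show ?thesis .
  qed
  have zC: "z (Suc k) \<in> C" and ApC: "A *v p \<in> C"
    using multiplier_normal[of k] yb by (auto simp: subdiff_indicator_def split: if_splits)
  \<comment> \<open>Monotonicity of the normal cone, obtained by adding the two defining
    inequalities.\<close>
  have "y (Suc k) \<bullet> (A *v p - z (Suc k)) \<le> 0" "yb \<bullet> (z (Suc k) - A *v p) \<le> 0"
    using multiplier_normal[of k] yb zC ApC by (auto simp: subdiff_indicator_def)
  then have "0 \<le> dy \<bullet> (z (Suc k) - A *v p)" by (simp add: dy_def inner_diff_left inner_diff_right)
  moreover have "z (Suc k) - A *v p = A *v dx - g" by (simp add: g_def dx_def matrix_vector_mult_diff_distrib)
  ultimately have "dy \<bullet> g \<le> dy \<bullet> (A *v dx)" by (simp add: inner_diff_right)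
  also have "\<dots> = (transpose A *v dy) \<bullet> dx" by (simp only: inner_transpose_mult)
  also have "\<dots> = e \<bullet> dx - dx \<bullet> (H *v dx)" unfolding e_eq
    by (simp only: inner_add_left inner_commute[of "H *v dx"])
  also have "\<dots> \<le> \<delta> k * norm dx - \<mu> * (norm dx)\<^sup>2"
  proof (rule diff_mono)
    show "e \<bullet> dx \<le> \<delta> k * norm dx"
      using norm_cauchy_schwarz[of e dx] mult_right_mono[OF e_le norm_ge_zero[of dx]] by linarith
    show "\<mu> * (norm dx)\<^sup>2 \<le> dx \<bullet> (H *v dx)" unfolding H_def by (rule \<mu>(2))
  qed
  also have "\<dots> \<le> (\<delta> k)\<^sup>2 / (4 * \<mu>)"
  \<comment> \<open>The right-hand side is the maximum of the concave quadratic in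
    \<open>norm dx\<close>; completing the square shows it.\<close>
  proof -
    have "0 \<le> (\<delta> k - 2 * \<mu> * norm dx)\<^sup>2" by simp
    then have "4 * \<mu> * (\<delta> k * norm dx - \<mu> * (norm dx)\<^sup>2) \<le> (\<delta> k)\<^sup>2"
      by (simp add: power2_eq_square algebra_simps)
    then show ?thesis using \<mu>(1) by (simp add: pos_le_divide_eq mult.commute)
  qed
  finally have dyg: "2 * (dy \<bullet> g) \<le> (\<delta> k)\<^sup>2 / (2 * \<mu>)" by simp
  \<comment> \<open>After a failed test the penalties can only grow, so the inverse weights do not
    increase.\<close>
  have "(\<Sum>j\<in>UNIV. (y (Suc k) $ j - yb $ j)\<^sup>2 / Sy (Suc k) $ j $ j) \<le> (\<Sum>j\<in>UNIV. (dy $ j)\<^sup>2 / Sy k $ j $ j)"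
  proof (rule sum_mono)
    fix j
    have "Sy k $ j $ j \<le> Sy (Suc k) $ j $ j" using test_fail[OF fail] loewner_ge_diag by blast
    then show "(y (Suc k) $ j - yb $ j)\<^sup>2 / Sy (Suc k) $ j $ j \<le> (dy $ j)\<^sup>2 / Sy k $ j $ j"
      unfolding dy_def using Sy_diag_pos[of k j] by (simp add: frac_le)
  qed
  also have "\<dots> = (\<Sum>j\<in>UNIV. (y k $ j - yb $ j)\<^sup>2 / Sy k $ j $ j + 2 * (dy $ j * g $ j) - Sy k $ j $ j * (g $ j)\<^sup>2)"
  proof (rule sum.cong)
    fix j
    have "y (Suc k) $ j = y k $ j + Sy k $ j $ j * g $ j"
      unfolding y_step g_def[symmetric] by (simp add: diagonal_mult_component[OF Sy_diagonal])
    then have yk: "y k $ j - yb $ j = dy $ j - Sy k $ j $ j * g $ j" by (simp add: dy_def)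
    have "d\<^sup>2 / s = (d - s * v)\<^sup>2 / s + 2 * (d * v) - s * v\<^sup>2" if "0 < s" for d s v :: real
      using that by (simp add: field_simps power2_eq_square)
    then show "(dy $ j)\<^sup>2 / Sy k $ j $ j
      = (y k $ j - yb $ j)\<^sup>2 / Sy k $ j $ j + 2 * (dy $ j * g $ j) - Sy k $ j $ j * (g $ j)\<^sup>2"
      unfolding yk using Sy_diag_pos[of k j] by blast
  qed simp
  also have "\<dots> = (\<Sum>j\<in>UNIV. (y k $ j - yb $ j)\<^sup>2 / Sy k $ j $ j) + 2 * (dy \<bullet> g) - g \<bullet> (Sy k *v g)"
    unfolding Sy_quadratic_form inner_vec_def[of dy] by (simp add: sum.distrib sum_subtractf sum_distrib_left)
  finally have le: "(\<Sum>j\<in>UNIV. (y (Suc k) $ j - yb $ j)\<^sup>2 / Sy (Suc k) $ j $ j)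
    \<le> (\<Sum>j\<in>UNIV. (y k $ j - yb $ j)\<^sup>2 / Sy k $ j $ j) + 2 * (dy \<bullet> g) - g \<bullet> (Sy k *v g)" .
  have "g \<bullet> (Sy k *v g) = (wnorm (Sy k) g)\<^sup>2"
  proof -
    have "0 \<le> g \<bullet> (Sy k *v g)" unfolding Sy_quadratic_form
      using Sy_diag_pos[of k] by (intro sum_nonneg mult_nonneg_nonneg) (auto simp: less_imp_le)
    then show ?thesis by (simp add: wnorm_def)
  qed
  then show ?thesis using dyg le unfolding g_def by linarith
qed

lemma infinitely_many_tests: "infinite {k. test k}"
proof
  assume "finite {k. test k}"
  then obtain K where "\<forall>k\<in>{k. test k}. k < K" using finite_nat_set_iff_bounded by blast
  then have fail: "\<not> test k" if "K \<le> k" for k using that by auto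
  have const: "xh k = xh K \<and> \<epsilon> k = \<epsilon> K" if "K \<le> k" for k
    using that
  proof (induction k rule: dec_induct)
    case (step k)
    then show ?case using test_fail[OF fail[of k]] by simp
  qed simp
  obtain \<mu> where \<mu>: "\<mu> > 0" "\<And>d. \<mu> * (norm d)\<^sup>2 \<le> d \<bullet> ((Q + matrix_inv Sx) *v d)"
    using pos_def_lower_bound[OF Q_Sx] by blast
  obtain p yb where kkt: "(Q + matrix_inv Sx) *v p + (q - matrix_inv Sx *v xh K) + transpose A *v yb = 0"
    "yb \<in> subdiff_indicator C (A *v p)"
    using strongly_convex_kkt_exists[OF C_def feasible Q_Sx] by blast
  define V where "V = (\<lambda>k. \<Sum>j\<in>UNIV. (y k $ j - yb $ j)\<^sup>2 / Sy k $ j $ j)"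
  \<comment> \<open>A failed test gains more than the square of \<open>\<epsilon> K\<close>. Half of
    it eventually pays for the inexactness, and \<open>h\<close> is the decrease that
    remains.\<close>
  define h where "h = (\<epsilon> K)\<^sup>2 / 2"
  have h: "h > 0" using eps_pos[of K] by (simp add: h_def)
  have "(\<lambda>k. (\<delta> k)\<^sup>2 / (2 * \<mu>)) \<longlonglongrightarrow> 0\<^sup>2 / (2 * \<mu>)" using \<mu>(1) by (intro tendsto_intros delta_tendsto) auto
  then have "\<forall>\<^sub>F k in sequentially. (\<delta> k)\<^sup>2 / (2 * \<mu>) < h" using h by (intro order_tendstoD) auto
  then obtain M0 where M0: "\<And>k. M0 \<le> k \<Longrightarrow> (\<delta> k)\<^sup>2 / (2 * \<mu>) < h" unfolding eventually_sequentially by blast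
  define M where "M = max K M0"
  have dec: "V (Suc k) \<le> V k - h" if k: "M \<le> k" for k
  proof -
    have kK: "K \<le> k" "M0 \<le> k" using k by (auto simp: M_def)
    have "V (Suc k) \<le> V k + (\<delta> k)\<^sup>2 / (2 * \<mu>) - (wnorm (Sy k) (A *v x (Suc k) - z (Suc k)))\<^sup>2"
      unfolding V_def using dual_fejer[OF \<mu> _ kkt(2) fail[OF kK(1)]] kkt(1) const[OF kK(1)] by simp
    moreover have "\<epsilon> K < wnorm (Sy k) (A *v x (Suc k) - z (Suc k))"
      using fail[OF kK(1)] const[OF kK(1)] by (simp add: palm_test_def)
    then have "(\<epsilon> K)\<^sup>2 \<le> (wnorm (Sy k) (A *v x (Suc k) - z (Suc k)))\<^sup>2"
      using eps_pos[of K] by (intro power_mono) auto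
    ultimately show ?thesis using M0[OF kK(2)] unfolding h_def by linarith
  qed
  have lin: "V (M + n) \<le> V M - real n * h" for n
  proof (induction n)
    case (Suc n)
    then show ?case using dec[of "M + n"] by (simp add: algebra_simps)
  qed simp
  have V0: "0 \<le> V k" for k unfolding V_def using Sy_diag_pos[of k] by (intro sum_nonneg) (auto simp: less_imp_le)
  obtain n where "V M < real n * h" using h reals_Archimedean3 by blast
  then show False using lin[of n] V0[of "M + n"] by linarith
qed

section \<open>The iterations that pass the test as an outer proximal point method\<close>

definition passes_before :: "nat \<Rightarrow> nat" where
  "passes_before k = card {j\<in>{k. test k}. j < k}"

lemma passes_before_Suc: "passes_before (Suc k) = passes_before k + (if test k then 1 else 0)"
proof -
  have "{j\<in>{k. test k}. j < Suc k} = {j\<in>{k. test k}. j < k} \<union> (if test k then {k} else {})"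
    by (auto simp: less_Suc_eq)
  then show ?thesis unfolding passes_before_def by (auto simp: card_insert_if)
qed

lemma mono_passes_before: "mono passes_before"
  by (intro mono_iff_le_Suc[THEN iffD2] allI) (simp add: passes_before_Suc)

lemma passes_before_enumerate: "passes_before (enumerate {k. test k} i) = i"
  unfolding passes_before_def by (rule enumerate_card_below[OF infinitely_many_tests])

lemma passes_before_at_top: "filterlim passes_before at_top sequentially"
  unfolding filterlim_at_top eventually_sequentially
  using monoD[OF mono_passes_before] passes_before_enumerate by metis

lemma eps_geometric: "\<epsilon> k \<le> \<rho> ^ passes_before k * \<epsilon> 0"
proof (induction k)
  case 0
  show ?case by (simp add: passes_before_def)
next
  case (Suc k)
  show ?case
  proof (cases "test k")
    case True
    then have "\<epsilon> (Suc k) \<le> \<rho> * \<epsilon> k" using test_pass by blast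
    also have "\<dots> \<le> \<rho> * (\<rho> ^ passes_before k * \<epsilon> 0)" using Suc rho by (intro mult_left_mono) auto
    finally show ?thesis using True by (simp add: passes_before_Suc)
  next
    case False
    then show ?thesis using Suc test_fail by (simp add: passes_before_Suc)
  qed
qed

abbreviation outer :: "nat \<Rightarrow> real^'n" where
  "outer i \<equiv> x (Suc (enumerate {k. test k} i))"

text \<open>The count must be positive: before the first passed test the center is the starting
  point, which is no outer iterate. After \<open>Suc i\<close> passes the latest one has enumeration
  index \<open>i\<close>.\<close>

lemma center_eq_outer: "passes_before k = Suc i \<Longrightarrow> xh k = outer i"
proof (induction k)
  case 0
  then show ?case by (simp add: passes_before_def)
next
  case (Suc k)
  show ?case
  proof (cases "test k")
    case True
    then obtain n where "enumerate {k. test k} n = k" using enumerate_Ex[of "{k. test k}" k] infinitely_many_tests by auto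
    moreover have "n = i" using calculation passes_before_enumerate[of n] Suc.prems True by (simp add: passes_before_Suc)
    ultimately show ?thesis using test_pass[OF True] by simp
  next
    case False
    then show ?thesis using Suc test_fail by (simp add: passes_before_Suc)
  qed
qed

text \<open>Infeasibility at the \<open>i\<close>-th pass inherits the \<open>i\<close> reductions
  of \<epsilon>. The stationarity error has been reduced at least as often, since the pass numbered
  \<open>Suc i\<close> cannot occur before iteration \<open>Suc i\<close>. That bound starts at
  \<open>Suc i\<close> because only then is the center an outer iterate.\<close>

lemma outer_residuals:
  obtains c where "0 \<le> c"
    "\<And>i. norm (z (Suc (enumerate {k. test k} i)) - A *v outer i) \<le> c * \<rho> ^ i"
    "\<And>i. norm (Q *v outer (Suc i) + q + transpose A *v y (Suc (enumerate {k. test k} (Suc i)))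
      + matrix_inv Sx *v (outer (Suc i) - outer i)) \<le> c * \<rho> ^ i"
proof -
  obtain s where s: "s > 0" "\<And>k v. norm v \<le> s * wnorm (Sy k) v" using norm_le_wnorm by blast
  have \<rho>p: "0 \<le> \<rho> ^ i" for i using rho by simp
  show ?thesis
  proof (rule that[of "max (s * \<epsilon> 0) (\<delta> 0)"])
    show "0 \<le> max (s * \<epsilon> 0) (\<delta> 0)" using delta_pos[of 0] by simp
    fix i
    define k where "k = enumerate {k. test k} i"
    have k: "test k" using enumerate_in_set[OF infinitely_many_tests, of i] by (simp add: k_def)
    have "norm (z (Suc k) - A *v x (Suc k)) = norm (A *v x (Suc k) - z (Suc k))" by (rule norm_minus_commute)
    also have "\<dots> \<le> s * wnorm (Sy k) (A *v x (Suc k) - z (Suc k))" by (rule s(2))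
    also have "\<dots> \<le> s * \<epsilon> k" using k s(1) unfolding palm_test_def by (intro mult_left_mono) auto
    also have "\<dots> \<le> s * (\<rho> ^ i * \<epsilon> 0)"
      using eps_geometric[of k] s(1) passes_before_enumerate[of i] unfolding k_def by (intro mult_left_mono) auto
    also have "\<dots> = (s * \<epsilon> 0) * \<rho> ^ i" by simp
    also have "\<dots> \<le> max (s * \<epsilon> 0) (\<delta> 0) * \<rho> ^ i" using \<rho>p by (intro mult_right_mono) auto
    finally show "norm (z (Suc (enumerate {k. test k} i)) - A *v outer i) \<le> max (s * \<epsilon> 0) (\<delta> 0) * \<rho> ^ i"
      by (simp add: k_def)
  next
    fix i
    define k where "k = enumerate {k. test k} (Suc i)"
    have xh: "xh k = outer i" unfolding k_def by (rule center_eq_outer[OF passes_before_enumerate])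
    have ik: "i \<le> k" using le_enumerate[OF infinitely_many_tests, of "Suc i"] by (simp add: k_def)
    have "norm (Q *v x (Suc k) + q + transpose A *v y (Suc k) + matrix_inv Sx *v (x (Suc k) - xh k)) \<le> \<rho> ^ k * \<delta> 0"
      using stationarity_residual[of k] delta_geometric[of k] by (rule order_trans)
    also have "\<dots> \<le> \<rho> ^ i * \<delta> 0" using rho delta_pos[of 0] ik by (intro mult_right_mono power_decreasing) auto
    also have "\<dots> \<le> max (s * \<epsilon> 0) (\<delta> 0) * \<rho> ^ i" using \<rho>p by (subst mult.commute) (intro mult_right_mono, auto)
    finally show "norm (Q *v outer (Suc i) + q + transpose A *v y (Suc (enumerate {k. test k} (Suc i)))
      + matrix_inv Sx *v (outer (Suc i) - outer i)) \<le> max (s * \<epsilon> 0) (\<delta> 0) * \<rho> ^ i"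
      unfolding xh unfolding k_def .
  qed
qed

lemma outer_convergence:
  obtains xs where "R_linear outer" "outer \<longlonglongrightarrow> xs"
    "stationary (\<lambda>x. ereal (f x) + indicator_ext C (A *v x)) xs"
proof -
  obtain p where p: "p > 0" "\<And>d. p * (norm d)\<^sup>2 \<le> d \<bullet> (matrix_inv Sx *v d)"
    using pos_def_inverse_lower_bound[OF Sx] by blast
  obtain c where c: "0 \<le> c"
    "\<And>i. norm (z (Suc (enumerate {k. test k} i)) - A *v outer i) \<le> c * \<rho> ^ i"
    "\<And>i. norm (Q *v outer (Suc i) + q + transpose A *v y (Suc (enumerate {k. test k} (Suc i)))
      + matrix_inv Sx *v (outer (Suc i) - outer i)) \<le> c * \<rho> ^ i"
    using outer_residuals by blast
  \<comment> \<open>With the perturbation taken as \<open>z\<close> minus the constraint value,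
    inexact feasibility becomes exact normality at a shifted point.\<close>
  have n: "y (Suc (enumerate {k. test k} i)) \<in> subdiff_indicator C
      (A *v outer i + (z (Suc (enumerate {k. test k} i)) - A *v outer i))" for i
    using multiplier_normal by simp
  obtain ws where "R_linear outer" "outer \<longlonglongrightarrow> ws" "A *v ws \<in> C"
    "\<And>x. A *v x \<in> C \<Longrightarrow> 0 \<le> (Q *v ws + q) \<bullet> (x - ws)"
    using inexact_proximal_point_R_linear[OF Q_Sx p rho c(1) n c(3) c(2)] by blast
  then show ?thesis using that variational_inequality_stationary by blast
qed

lemma centers_converge:
  assumes "outer \<longlonglongrightarrow> xs"
  shows "xh \<longlonglongrightarrow> xs"
proof -
  \<comment> \<open>Truncated subtraction is wrong only before the first pass, which the limit does
    not see.\<close>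
  have "filterlim (\<lambda>k. passes_before k - 1) at_top sequentially"
    using passes_before_at_top filterlim_minus_const_nat_at_top[of 1] by (rule filterlim_compose[rotated])
  from filterlim_compose[OF assms this] have "(\<lambda>k. outer (passes_before k - 1)) \<longlonglongrightarrow> xs" .
  moreover have "\<forall>\<^sub>F k in sequentially. outer (passes_before k - 1) = xh k"
  proof -
    have "\<forall>\<^sub>F k in sequentially. 1 \<le> passes_before k"
      using passes_before_at_top unfolding filterlim_at_top by blast
    then show ?thesis
    proof eventually_elim
      case (elim k)
      then have "passes_before k = Suc (passes_before k - 1)" by simp
      from center_eq_outer[OF this] show ?case by simp
    qed
  qed
  ultimately show ?thesis by (rule Lim_transform_eventually)
qed

lemma termination_criteria_met:
  assumes "0 < eps_p" "0 < eps_d"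
  shows "\<exists>k. norm (gradient f (x (Suc k)) + transpose A *v y (Suc k)) \<le> eps_d
    \<and> y (Suc k) \<in> subdiff_indicator C (z (Suc k)) \<and> norm (A *v x (Suc k) - z (Suc k)) \<le> eps_p"
proof -
  let ?k = "enumerate {k. test k}"
  obtain xs where xs: "outer \<longlonglongrightarrow> xs" using outer_convergence by blast
  obtain c where c: "\<And>i. norm (z (Suc (?k i)) - A *v outer i) \<le> c * \<rho> ^ i"
    using outer_residuals by blast
  have sub: "strict_mono ?k" using enumerate_mono[OF _ infinitely_many_tests] by (simp add: strict_mono_def)
  \<comment> \<open>Termination is sought at passed tests after the first, where the proximal
    displacement is a difference of consecutive outer iterates and hence tends to zero.\<close>
  have "(\<lambda>i. \<delta> (?k (Suc i))) \<longlonglongrightarrow> 0" using LIMSEQ_Suc[OF LIMSEQ_subseq_LIMSEQ[OF delta_tendsto sub]] by (simp add: o_def)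
  moreover have "(\<lambda>i. norm (matrix_inv Sx *v (outer (Suc i) - outer i))) \<longlonglongrightarrow> norm (matrix_inv Sx *v (xs - xs))"
    by (intro tendsto_intros bounded_linear.tendsto[OF matrix_vector_mul_bounded_linear] LIMSEQ_Suc[OF xs] xs)
  ultimately have "(\<lambda>i. \<delta> (?k (Suc i)) + norm (matrix_inv Sx *v (outer (Suc i) - outer i)))
      \<longlonglongrightarrow> 0 + norm (matrix_inv Sx *v (xs - xs))" by (rule tendsto_add)
  then have "\<forall>\<^sub>F i in sequentially. \<delta> (?k (Suc i)) + norm (matrix_inv Sx *v (outer (Suc i) - outer i)) < eps_d"
    using assms(2) by (intro order_tendstoD) auto
  moreover have "(\<lambda>i. c * \<rho> ^ Suc i) \<longlonglongrightarrow> c * 0"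
    using rho by (intro tendsto_intros LIMSEQ_Suc[OF LIMSEQ_power_zero]) auto
  then have "\<forall>\<^sub>F i in sequentially. c * \<rho> ^ Suc i < eps_p" using assms(1) by (intro order_tendstoD) auto
  ultimately have "\<forall>\<^sub>F i in sequentially. \<delta> (?k (Suc i)) + norm (matrix_inv Sx *v (outer (Suc i) - outer i)) < eps_d
      \<and> c * \<rho> ^ Suc i < eps_p" by (rule eventually_conj)
  then obtain i where i: "\<delta> (?k (Suc i)) + norm (matrix_inv Sx *v (outer (Suc i) - outer i)) < eps_d" "c * \<rho> ^ Suc i < eps_p"
    using eventually_happens'[OF sequentially_bot] by blast
  have "xh (?k (Suc i)) = outer i" by (rule center_eq_outer[OF passes_before_enumerate])
  then have "norm (gradient f (outer (Suc i)) + transpose A *v y (Suc (?k (Suc i)))) \<le> eps_d"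
    using dual_residual_bound[of "?k (Suc i)"] i(1) by simp
  moreover have "norm (A *v outer (Suc i) - z (Suc (?k (Suc i)))) \<le> eps_p"
    using c[of "Suc i"] i(2) by (simp add: norm_minus_commute)
  ultimately show ?thesis using multiplier_normal by blast
qed

end

theorem theorem2p6:
  fixes Q :: "real^'n^'n" and q :: "real^'n" and A :: "real^'n^'m" and l u :: "real^'m"
    and C :: "(real^'m) set" and f :: "real^'n \<Rightarrow> real"
    and Sx :: "real^'n^'n" and Symin :: "real^'m^'m" and Sy :: "nat \<Rightarrow> real^'m^'m"
    and \<rho> :: real and \<delta> \<epsilon> :: "nat \<Rightarrow> real"
    and x xh :: "nat \<Rightarrow> real^'n" and y z :: "nat \<Rightarrow> real^'m"
  assumes Q_sym: "transpose Q = Q"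
    and C_def: "C = {z. \<forall>i. l $ i \<le> z $ i \<and> z $ i \<le> u $ i}"
    and f_def: "f = (\<lambda>x. 1/2 * (x \<bullet> (Q *v x)) + q \<bullet> x)"
    and feasible: "{x. A *v x \<in> C} \<noteq> {}"
    and lower_bounded: "bdd_below (f ` {x. A *v x \<in> C})"
    and run: "palm_run Q q A C Sx Symin Sy \<rho> \<delta> \<epsilon> x z y xh"
  shows
    "(\<forall>k. norm (gradient f (x (Suc k)) + transpose A *v y (Suc k))
              \<le> \<delta> k + norm (matrix_inv Sx *v (x (Suc k) - xh k))
          \<and> y (Suc k) \<in> subdiff_indicator C (z (Suc k)))
     \<and> (infinite {k. palm_test A Sy \<epsilon> x z k}
        \<and> (\<lambda>k. norm (xh (Suc k) - xh k)) \<longlonglongrightarrow> 0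
        \<and> (\<forall>eps_p>0. \<forall>eps_d>0. \<exists>k.
              norm (gradient f (x (Suc k)) + transpose A *v y (Suc k)) \<le> eps_d
              \<and> y (Suc k) \<in> subdiff_indicator C (z (Suc k))
              \<and> norm (A *v x (Suc k) - z (Suc k)) \<le> eps_p))
     \<and> ((\<exists>xstar. xh \<longlonglongrightarrow> xstar
            \<and> stationary (\<lambda>x. ereal (f x) + indicator_ext C (A *v x)) xstar)
        \<and> R_linear (\<lambda>i. x (Suc (enumerate {k. palm_test A Sy \<epsilon> x z k} i))))"
proof -
  interpret palm_run Q q A C Sx Symin Sy \<rho> \<delta> \<epsilon> x z y xh by (rule run)
  interpret palm_box_qp Q q A l u C f Sx Symin Sy \<rho> \<delta> \<epsilon> x z y xh
    by unfold_locales (rule Q_sym C_def f_def feasible lower_bounded)+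
  obtain xs where xs: "R_linear outer" "outer \<longlonglongrightarrow> xs"
    "stationary (\<lambda>x. ereal (f x) + indicator_ext C (A *v x)) xs"
    using outer_convergence by blast
  have xh: "xh \<longlonglongrightarrow> xs" using xs(2) by (rule centers_converge)
  have "(\<lambda>k. norm (xh (Suc k) - xh k)) \<longlonglongrightarrow> norm (xs - xs)"
    by (intro tendsto_intros LIMSEQ_Suc[OF xh] xh)
  then have "(\<lambda>k. norm (xh (Suc k) - xh k)) \<longlonglongrightarrow> 0" by simp
  then show ?thesis
    using dual_residual_bound multiplier_normal infinitely_many_tests termination_criteria_met xh xs(1,3) by blast
qed

end
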